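(* Let $\boldsymbol\tau = (\tau_n \colon \mathcal A_{n+1}^* \to \mathcal A_n^* )_{n\geq 0}$ be a primitive and recognizable directive sequence. A real number $\alpha$ is a continuous eigenvalue of $X_{\boldsymbol\tau}$ if and only if there exists a family of real numbers $(\rho_n(a) : n \geq 0,\ a \in \mathcal A_n)$ such that $$\sup\Big\{ \big\| \rho_n(u_0) - \rho_n(u_k) + \alpha\, h_n(u_0 u_1\cdots u_{k-1}) \big\| : u_0 u_1\cdots u_k \in \mathcal L(X_{\boldsymbol\tau}^{(n)}),\ u_0,\dots,u_k\in\mathcal A_n \Big\}$$ converges to $0$ as $n \to \infty$.
   Context: Alphabets are finite sets with at least two elements. $\mathcal A^*$ is the free monoid of finite words over $\mathcal A$ and $|w|$ is the length of $w$. $S$ is the shift map $S((x_k)_k)=(x_{k+1})_k$ on $\mathcal A^{\mathbb Z}$; a subshift is a closed set $X\subseteq\mathcal A^{\mathbb Z}$ with $S(X)=X$; $\mathcal L(X)$ is the set of finite words occurring in points of $X$. A substitution $\tau:\mathcal A^*\to\mathcal B^*$ is a monoid morphism such that $\tau(a)$ is non-empty for every $a\in\mathcal A$ and every $b\in\mathcal B$ occurs in some $\tau(a)$; it acts on $x\in\mathcal A^{\mathbb Z}$ by concatenation, with $\tau(x_0)$ starting at coordinate $0$. A directive sequence $\boldsymbol\tau=(\tau_n)_{n\ge0}$ consists of substitutions $\tau_n:\mathcal A_{n+1}^*\to\mathcal A_n^*$. Put $\tau_{n,m}=\tau_n\circ\tau_{n+1}\circ\cdots\circ\tau_{m-1}$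 for $m>n$. $X^{(n)}_{\boldsymbol\tau}$ is the set of $x\in\mathcal A_n^{\mathbb Z}$ such that every finite factor of $x$ occurs in $\tau_{n,m}(a)$ for some $m>n$ and $a\in\mathcal A_m$; $X_{\boldsymbol\tau}=X^{(0)}_{\boldsymbol\tau}$. Heights: $h_n(u)=|\tau_{0,n}(u)|$ for $u\in\mathcal A_n^*$, $n\ge1$, and $h_0(u)=|u|$. $\boldsymbol\tau$ is primitive if for every $n$ there is $m>n$ such that every letter of $\mathcal A_n$ occurs in $\tau_{n,m}(a)$ for every $a\in\mathcal A_m$. $\boldsymbol\tau$ is recognizable if, for every $n\ge1$, the sets $S^kB_n(a)$ ($a\in\mathcal A_n$, $0\le k<h_n(a)$) are pairwise disjoint, where $B_n(a)=\{\tau_{0,n}(x):x\in X^{(n)}_{\boldsymbol\tau},\ x_0=a\}$. A real number $\alpha$ is a continuous (additive) eigenvalue of a subshift $X$ if there is a continuous $g:X\to\mathbb R/\mathbb Z$ with $g(Sx)=g(x)+\alpha \pmod{\mathbb Z}$ for all $x\in X$. For $x\in\mathbb R$, $\|x\|$ is the distance from $x$ to the nearest integer. *)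

theory Defs
  imports "HOL-Analysis.Analysis" "HOL-Library.Sublist"
begin

section \<open>Words, bi-infinite sequences, substitutions\<close>

definition biinf :: "'a set \<Rightarrow> (int \<Rightarrow> 'a) set" where
  "biinf A = UNIV \<rightarrow>\<^sub>E A"

definition shift :: "(int \<Rightarrow> 'a) \<Rightarrow> int \<Rightarrow> 'a" where
  "shift x = (\<lambda>k. x (k + 1))"

definition factors :: "(int \<Rightarrow> 'a) \<Rightarrow> 'a list set" where
  "factors x = {map x [i..j] | i j. True}"

definition lang :: "(int \<Rightarrow> 'a) set \<Rightarrow> 'a list set" where
  "lang X = (\<Union>x\<in>X. factors x)"

text \<open>\<^term>\<open>lists A\<close> is the free monoid over \<^term>\<open>A\<close>; \<open>is_substitution A B t\<close> says that
  \<open>t\<close> is a substitution from \<open>A\<close> to \<open>B\<close>. Values of \<open>t\<close> outside \<^term>\<open>lists A\<close> are irrelevant.\<close>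

definition is_substitution :: "'a set \<Rightarrow> 'b set \<Rightarrow> ('a list \<Rightarrow> 'b list) \<Rightarrow> bool" where
  "is_substitution A B t \<longleftrightarrow>
     t \<in> lists A \<rightarrow> lists B \<and>
     t [] = [] \<and>
     (\<forall>u\<in>lists A. \<forall>v\<in>lists A. t (u @ v) = t u @ t v) \<and>
     (\<forall>a\<in>A. t [a] \<noteq> []) \<and>
     (\<forall>b\<in>B. \<exists>a\<in>A. b \<in> set (t [a]))"

text \<open>Action on bi-infinite sequences. As \<open>t\<close> is non-erasing, \<open>t (x\<^sub>0 \<dots> x\<^sub>k)\<close> has more than \<open>k\<close>
  letters, so it determines coordinate \<open>k \<ge> 0\<close> of the image; likewise \<open>t (x\<^sub>k \<dots> x\<^sub>-\<^sub>1)\<close>, which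
  ends at coordinate \<open>-1\<close>, determines coordinate \<open>k < 0\<close>. Lemma \<open>subst_biinf_block\<close> below
  confirms that the result is the concatenation of the words \<open>t (x\<^sub>j)\<close>, with \<open>t (x\<^sub>0)\<close> starting at
  coordinate \<open>0\<close>.\<close>

definition subst_biinf :: "('a list \<Rightarrow> 'b list) \<Rightarrow> (int \<Rightarrow> 'a) \<Rightarrow> int \<Rightarrow> 'b" where
  "subst_biinf t x k =
     (if 0 \<le> k then t (map x [0..k]) ! nat k
      else let w = t (map x [k..-1]) in w ! nat (int (length w) + k))"

text \<open>The coordinate at which the block \<open>t (x\<^sub>j)\<close> starts.\<close>

definition cut :: "('a list \<Rightarrow> 'b list) \<Rightarrow> (int \<Rightarrow> 'a) \<Rightarrow> int \<Rightarrow> int" where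
  "cut t x j = (if 0 \<le> j then int (length (t (map x [0..j - 1])))
                else - int (length (t (map x [j..-1]))))"

lemma is_substitution_length:
  assumes "is_substitution A B t" "w \<in> lists A"
  shows "length w \<le> length (t w)"
  using assms(2)
proof (induction w)
  case (Cons a w)
  have "t ([a] @ w) = t [a] @ t w" "t [a] \<noteq> []"
    using assms(1) Cons.hyps unfolding is_substitution_def by (metis Cons.hyps lists.simps)+
  then show ?case using Cons.IH by (cases "t [a]") auto
qed simp

lemma subst_biinf_block:
  assumes t: "is_substitution A B t" and x: "x \<in> biinf A" and r: "r < length (t [x j])"
  shows "subst_biinf t x (cut t x j + int r) = t [x j] ! r"
proof -
  have l: "map x s \<in> lists A" for s using x by (auto simp: biinf_def PiE_iff)
  have app: "t (map x (s @ s')) = t (map x s) @ t (map x s')" for s s'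
    using t l[of s] l[of s'] by (simp add: is_substitution_def)
  have len: "length s \<le> length (t (map x s))" for s
    using is_substitution_length[OF t l[of s]] by simp
  have three: "[a..b] = [a..j - 1] @ [j] @ [j + 1..b]" if "a \<le> j" "j \<le> b" for a b
    using that by (metis append_Cons append_Nil upto_rec1 upto_split1)
  define k where "k = cut t x j + int r"
  show ?thesis
  proof (cases "0 \<le> j")
    case True
    have jk: "j \<le> k" using len[of "[0..j - 1]"] True by (simp add: k_def cut_def)
    have "t (map x [0..k]) = t (map x [0..j - 1]) @ t [x j] @ t (map x [j + 1..k])"
      unfolding three[OF True jk] app by simp
    moreover have "nat k = length (t (map x [0..j - 1])) + r"
      using True by (simp add: k_def cut_def)
    ultimately show ?thesis
      using r True jk unfolding k_def[symmetric] by (simp add: subst_biinf_def nth_append)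
  next
    case False
    have e: "t (map x [j..-1]) = t [x j] @ t (map x [j + 1..-1])"
      using three[of j "-1"] False app[of "[j]" "[j + 1..-1]"] by simp
    have k: "k = int r - int (length (t [x j])) - int (length (t (map x [j + 1..-1])))"
      using False by (simp add: k_def cut_def e)
    have kj: "k \<le> j" using len[of "[j + 1..-1]"] False r k by simp
    have w: "t (map x [k..-1]) = t (map x [k..j - 1]) @ t [x j] @ t (map x [j + 1..-1])"
      using three[OF kj, of "-1"] False app[of "[k..j - 1]" "[j] @ [j + 1..-1]"]
        app[of "[j]" "[j + 1..-1]"] by simp
    have "nat (int (length (t (map x [k..-1]))) + k) = length (t (map x [k..j - 1])) + r"
      using w k by (auto simp: nat_eq_iff)
    then show ?thesis
      using r False kj unfolding k_def[symmetric]
      by (simp add: subst_biinf_def Let_def w nth_append)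
  qed
qed


section \<open>Directive sequences\<close>

definition directive_seq :: "(nat \<Rightarrow> 'a set) \<Rightarrow> (nat \<Rightarrow> 'a list \<Rightarrow> 'a list) \<Rightarrow> bool" where
  "directive_seq A \<tau> \<longleftrightarrow>
     (\<forall>n. finite (A n) \<and> 2 \<le> card (A n) \<and> is_substitution (A (Suc n)) (A n) (\<tau> n))"

text \<open>\<open>\<tau>\<^sub>n \<circ> \<dots> \<circ> \<tau>\<^sub>m\<^sub>-\<^sub>1\<close>; this is the identity for \<open>m = n\<close>, whence \<open>h\<^sub>0(u) = |u|\<close> below.\<close>

definition comp_from_to :: "(nat \<Rightarrow> 'a list \<Rightarrow> 'a list) \<Rightarrow> nat \<Rightarrow> nat \<Rightarrow> 'a list \<Rightarrow> 'a list" where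
  "comp_from_to \<tau> n m = foldr (\<circ>) (map \<tau> [n..<m]) id"

definition height :: "(nat \<Rightarrow> 'a list \<Rightarrow> 'a list) \<Rightarrow> nat \<Rightarrow> 'a list \<Rightarrow> nat" where
  "height \<tau> n u = length (comp_from_to \<tau> 0 n u)"

definition level_shift ::
    "(nat \<Rightarrow> 'a set) \<Rightarrow> (nat \<Rightarrow> 'a list \<Rightarrow> 'a list) \<Rightarrow> nat \<Rightarrow> (int \<Rightarrow> 'a) set" where
  "level_shift A \<tau> n =
     {x \<in> biinf (A n). \<forall>w\<in>factors x. \<exists>m>n. \<exists>a\<in>A m. sublist w (comp_from_to \<tau> n m [a])}"

definition primitive :: "(nat \<Rightarrow> 'a set) \<Rightarrow> (nat \<Rightarrow> 'a list \<Rightarrow> 'a list) \<Rightarrow> bool" where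
  "primitive A \<tau> \<longleftrightarrow>
     (\<forall>n. \<exists>m>n. \<forall>b\<in>A n. \<forall>a\<in>A m. b \<in> set (comp_from_to \<tau> n m [a]))"

definition base ::
    "(nat \<Rightarrow> 'a set) \<Rightarrow> (nat \<Rightarrow> 'a list \<Rightarrow> 'a list) \<Rightarrow> nat \<Rightarrow> 'a \<Rightarrow> (int \<Rightarrow> 'a) set" where
  "base A \<tau> n a = subst_biinf (comp_from_to \<tau> 0 n) ` {x \<in> level_shift A \<tau> n. x 0 = a}"

definition recognizable :: "(nat \<Rightarrow> 'a set) \<Rightarrow> (nat \<Rightarrow> 'a list \<Rightarrow> 'a list) \<Rightarrow> bool" where
  "recognizable A \<tau> \<longleftrightarrow>
     (\<forall>n\<ge>1. disjoint_family_on (\<lambda>(a, k). (shift ^^ k) ` base A \<tau> n a)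
               (SIGMA a:A n. {..<height \<tau> n [a]}))"


section \<open>The circle \<open>\<real>/\<int>\<close> and continuous eigenvalues\<close>

quotient_type rmodz = real / "\<lambda>x y. x - y \<in> \<int>" morphisms rep_rmodz rmodz
proof (rule equivpI)
  show "reflp (\<lambda>x y::real. x - y \<in> \<int>)" by (simp add: reflp_def)
  show "symp (\<lambda>x y::real. x - y \<in> \<int>)" by (metis (no_types, lifting) Ints_minus minus_diff_eq sympI)
  show "transp (\<lambda>x y::real. x - y \<in> \<int>)"
  proof (rule transpI)
    fix x y z :: real
    assume "x - y \<in> \<int>" "y - z \<in> \<int>"
    then have "(x - y) + (y - z) \<in> \<int>" by (rule Ints_add)
    then show "x - z \<in> \<int>" by simp
  qed
qed

instantiation rmodz :: ab_group_add
begin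

lift_definition zero_rmodz :: rmodz is 0 .

lift_definition plus_rmodz :: "rmodz \<Rightarrow> rmodz \<Rightarrow> rmodz" is "(+)"
proof -
  fix a b c d :: real
  assume "a - b \<in> \<int>" "c - d \<in> \<int>"
  then have "(a - b) + (c - d) \<in> \<int>" by (rule Ints_add)
  then show "a + c - (b + d) \<in> \<int>" by (simp add: algebra_simps)
qed

lift_definition uminus_rmodz :: "rmodz \<Rightarrow> rmodz" is uminus
  by (metis (no_types, lifting) Ints_minus minus_diff_minus)

lift_definition minus_rmodz :: "rmodz \<Rightarrow> rmodz \<Rightarrow> rmodz" is "(-)"
proof -
  fix a b c d :: real
  assume "a - b \<in> \<int>" "c - d \<in> \<int>"
  then have "(a - b) - (c - d) \<in> \<int>" by (rule Ints_diff)
  then show "a - c - (b - d) \<in> \<int>" by (simp add: algebra_simps)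
qed

instance by standard (transfer; simp)+

end

text \<open>Quotient topology of the usual topology on the reals.\<close>

instantiation rmodz :: topological_space
begin

definition open_rmodz :: "rmodz set \<Rightarrow> bool" where
  "open_rmodz U \<longleftrightarrow> open (rmodz -` U)"

instance
proof
  show "open (UNIV :: rmodz set)" by (simp add: open_rmodz_def)
  show "open (S \<inter> T)" if "open S" "open T" for S T :: "rmodz set"
    using that by (simp add: open_rmodz_def open_Int)
  show "open (\<Union>K)" if "\<forall>S\<in>K. open S" for K :: "rmodz set set"
    using that by (simp add: open_rmodz_def vimage_Union open_UN)
qed

end

text \<open>\<^term>\<open>biinf A\<close> with the product of the discrete topologies.\<close>

definition biinf_topology :: "'a set \<Rightarrow> (int \<Rightarrow> 'a) topology" where
  "biinf_topology A = product_topology (\<lambda>_. discrete_topology A) UNIV"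

definition continuous_eigenvalue :: "'a set \<Rightarrow> (int \<Rightarrow> 'a) set \<Rightarrow> real \<Rightarrow> bool" where
  "continuous_eigenvalue A X \<alpha> \<longleftrightarrow>
     (\<exists>g :: (int \<Rightarrow> 'a) \<Rightarrow> rmodz.
        continuous_map (subtopology (biinf_topology A) X) euclidean g \<and>
        (\<forall>x\<in>X. g (shift x) = g x + rmodz \<alpha>))"

definition dist_int :: "real \<Rightarrow> real" where
  "dist_int x = infdist x \<int>"

end

theory Submission
  imports Defs
begin

text \<open>
  Write \<open>X\<^sub>n\<close> for the subshift of level \<open>n\<close> and \<open>t\<^sub>n\<close> for the composed substitution from level \<open>n\<close> down to
  level 0. The points \<open>S\<^sup>k (t\<^sub>n y)\<close> with \<open>y \<in> X\<^sub>n\<close>, \<open>y\<^sub>0 = a\<close> and \<open>0 \<le> k < h\<^sub>n(a)\<close> form the tower over \<open>a\<close>, and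
  moving upwards in a tower is one application of the shift. A factor \<open>u\<^sub>0 \<dots> u\<^sub>k\<close> of a point of \<open>X\<^sub>n\<close>
  records an orbit segment that leaves the base of the tower over \<open>u\<^sub>0\<close> and arrives, after
  \<open>h\<^sub>n(u\<^sub>0 \<dots> u\<^sub>k\<^sub>-\<^sub>1)\<close> steps, in the base of the tower over \<open>u\<^sub>k\<close>. The number \<open>\<rho>\<^sub>n(a)\<close> stands for an
  approximate value of an eigenfunction on the base over \<open>a\<close>; the quantity in the theorem measures how
  far these values are from satisfying the eigenvalue equation along such segments.

  Suppose \<open>g\<close> is a continuous eigenfunction, and let \<open>\<rho>\<^sub>n(a)\<close> be the value of \<open>g\<close> at some point of the
  base over \<open>a\<close>. Two points of that base share the word \<open>t\<^sub>n(a)\<close> to the right of the origin but may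
  differ to the left. This is enough: applying the shift \<open>N\<close> times changes both values of \<open>g\<close> by the
  same amount and turns agreement on \<open>[0, 2N]\<close> into agreement on \<open>[-N, N]\<close>, so uniform continuity
  applies (\<open>eigenfunction_near\<close>). Primitivity makes the lengths of the \<open>t\<^sub>n(a)\<close> tend to infinity, hence
  \<open>g\<close> is almost constant on each base and the defects tend to 0.

  Conversely, given \<open>\<rho>\<close>, define \<open>G\<^sub>n = \<rho>\<^sub>n(a) + k \<alpha>\<close> on the \<open>k\<close>-th floor of the tower over \<open>a\<close>. The
  floors are compact, by recognizability they are disjoint, and they cover \<open>X\<^sub>0\<close>
  (\<open>level_shift_towers\<close>); so each floor is also relatively open, and \<open>G\<^sub>n\<close> is a well-defined locally
  constant function (\<open>tower_function\<close>). The hypothesis says that \<open>G\<^sub>n\<close> satisfies the eigenvalue equation,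
  for any number of steps, up to an error \<open>\<epsilon>\<^sub>n \<longlonglongrightarrow> 0\<close>. Fix a point \<open>x\<^sub>0\<close>. Its forward orbit is dense
  (\<open>dense_forward_orbit\<close>). If \<open>S\<^sup>k x\<^sub>0\<close> is close enough to \<open>x\<close>, then \<open>G\<^sub>n x - G\<^sub>n x\<^sub>0\<close> is within \<open>\<epsilon>\<^sub>n\<close> of
  \<open>k \<alpha>\<close> modulo 1. Therefore, modulo 1, any limit point of such \<open>k \<alpha>\<close> is within \<open>\<epsilon>\<^sub>n\<close> of \<open>G\<^sub>n x - G\<^sub>n x\<^sub>0\<close>
  for all \<open>n\<close> at once, and is the value at \<open>x\<close> of an eigenfunction, continuous as a uniform limit
  (\<open>continuous_eigenvalue_if_approximations\<close>).
\<close>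

section \<open>Distance to the integers and the norm of the circle\<close>

text \<open>Most facts on \<^const>\<open>dist_int\<close> below follow by choosing a nearest
  integer for each argument and comparing with the sum or the negative of these integers.\<close>

lemma dist_int_attained:
  obtains k where "k \<in> \<int>" "dist_int x = \<bar>x - k\<bar>"
proof -
  have "\<exists>k\<in>\<int>. infdist x \<int> = dist x k"
    using infdist_attains_inf[of "\<int> :: real set" x] Ints_0 closed_Ints by blast
  then show ?thesis using that by (auto simp: dist_int_def dist_real_def)
qed

lemma dist_int_le: "k \<in> \<int> \<Longrightarrow> dist_int x \<le> \<bar>x - k\<bar>"
  using infdist_le[of k \<int> x] by (simp add: dist_int_def dist_real_def)

lemma dist_int_nonneg: "0 \<le> dist_int x"
  by (simp add: dist_int_def infdist_nonneg)

lemma dist_int_le_1: "dist_int x \<le> 1"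
proof -
  have "\<bar>x - of_int \<lfloor>x\<rfloor>\<bar> \<le> 1" by linarith
  then show ?thesis using dist_int_le[of "of_int \<lfloor>x\<rfloor>" x] by simp
qed

lemma dist_int_add: "dist_int (x + y) \<le> dist_int x + dist_int y"
proof -
  obtain k l where "k \<in> \<int>" "dist_int x = \<bar>x - k\<bar>" "l \<in> \<int>" "dist_int y = \<bar>y - l\<bar>"
    by (metis dist_int_attained)
  then show ?thesis using dist_int_le[of "k + l" "x + y"] by simp
qed

lemma dist_int_minus: "dist_int (- x) = dist_int x"
proof -
  have "dist_int (- y) \<le> dist_int y" for y
  proof -
    obtain k where "k \<in> \<int>" "dist_int y = \<bar>y - k\<bar>" by (rule dist_int_attained)
    then show ?thesis using dist_int_le[of "- k" "- y"] by simp
  qed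
  from this[of x] this[of "- x"] show ?thesis by simp
qed

lemma dist_int_cong:
  assumes "x - y \<in> \<int>" shows "dist_int x = dist_int y"
proof -
  have "dist_int x \<le> dist_int y" if "x - y \<in> \<int>" for x y
  proof -
    have "dist_int (x - y) = 0"
      using dist_int_le[OF that, of "x - y"] dist_int_nonneg[of "x - y"] by simp
    then show ?thesis using dist_int_add[of "x - y" y] by simp
  qed
  moreover have "y - x \<in> \<int>" using Ints_minus[OF assms] by simp
  ultimately show ?thesis using assms by (metis antisym)
qed

lemma dist_int_eq_0D: "dist_int x = 0 \<Longrightarrow> x \<in> \<int>"
  by (rule dist_int_attained[of x]) auto

lemma continuous_dist_int: "continuous_on S f \<Longrightarrow> continuous_on S (\<lambda>x. dist_int (f x))"
  unfolding dist_int_def by (intro continuous_intros)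

text \<open>The circle carries only the quotient topology, so estimates need a metric. This norm
  provides it: \<^const>\<open>dist_int\<close> does not change under integer translations and so
  descends to the quotient.\<close>

lift_definition circle_norm :: "rmodz \<Rightarrow> real" is dist_int
  by (rule dist_int_cong)

lemma circle_norm_add: "circle_norm (x + y) \<le> circle_norm x + circle_norm y"
  by transfer (rule dist_int_add)

lemma circle_norm_minus: "circle_norm (- x) = circle_norm x"
  by transfer (rule dist_int_minus)

lemma circle_norm_triangle: "circle_norm (x - z) \<le> circle_norm (x - y) + circle_norm (y - z)"
  using circle_norm_add[of "x - y" "y - z"] by simp

lemma circle_norm_commute: "circle_norm (x - y) = circle_norm (y - x)"
  using circle_norm_minus[of "x - y"] by simp

lemma circle_norm_diff_self: "circle_norm (x - x) = 0"
  by transfer (use dist_int_le[of 0 0] dist_int_nonneg[of 0] in simp)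

lemma rmodz_eq_iff: "rmodz x = rmodz y \<longleftrightarrow> x - y \<in> \<int>"
  by (rule rmodz.abs_eq_iff)

lemma rmodz_rep: "rmodz (rep_rmodz z) = z"
  by (rule Quotient_abs_rep[OF Quotient_rmodz])

lemma open_circle_ball: "open {z. circle_norm (z - c) < e}"
proof -
  have "circle_norm (rmodz t - c) = dist_int (t - rep_rmodz c)" for t
    by (subst rmodz_rep[of c, symmetric]) (simp only: minus_rmodz.abs_eq circle_norm.abs_eq)
  then have "rmodz -` {z. circle_norm (z - c) < e} = {t. dist_int (t - rep_rmodz c) < e}"
    by auto
  moreover have "open {t. dist_int (t - rep_rmodz c) < e}"
    by (intro open_Collect_less continuous_dist_int continuous_intros)
  ultimately show ?thesis by (simp add: open_rmodz_def)
qed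

text \<open>The radius is that of an interval around \<open>t\<close> inside the preimage of
  \<open>U\<close>: a real number close to \<open>t\<close> modulo 1 has an integer translate in
  this interval, and the translate has the same class.\<close>

lemma open_circle_contains_ball:
  assumes "open U" "rmodz t \<in> U"
  obtains e where "e > 0" "\<And>s. dist_int (s - t) < e \<Longrightarrow> rmodz s \<in> U"
proof -
  have "open (rmodz -` U)" "t \<in> rmodz -` U" using assms by (auto simp: open_rmodz_def)
  then obtain e where e: "e > 0" "\<And>s. dist s t < e \<Longrightarrow> rmodz s \<in> U"
    unfolding open_dist by auto
  show ?thesis
  proof (rule that[OF e(1)])
    fix s assume "dist_int (s - t) < e"
    then obtain k where k: "k \<in> \<int>" "\<bar>s - t - k\<bar> < e" by (metis dist_int_attained)
    then have "rmodz (s - k) \<in> U" by (intro e(2)) (simp add: dist_real_def algebra_simps)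
    moreover have "rmodz (s - k) = rmodz s" using k by (simp add: rmodz_eq_iff)
    ultimately show "rmodz s \<in> U" by simp
  qed
qed

section \<open>The topology of bi-infinite sequences\<close>

text \<open>Agreement on the window \<open>[-N, N]\<close>. The sets of points that agree with
  \<open>x\<close> on a window form a neighbourhood base at \<open>x\<close>, so all topological
  statements below are translated into statements about windows.\<close>

definition agree :: "nat \<Rightarrow> (int \<Rightarrow> 'a) \<Rightarrow> (int \<Rightarrow> 'a) \<Rightarrow> bool" where
  "agree N x y \<longleftrightarrow> (\<forall>i. \<bar>i\<bar> \<le> int N \<longrightarrow> x i = y i)"

lemma agree_mono: "agree N x y \<Longrightarrow> M \<le> N \<Longrightarrow> agree M x y"
  by (auto simp: agree_def)

lemma agree_refl: "agree N x x"
  by (simp add: agree_def)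

lemma agree_trans: "agree N x y \<Longrightarrow> agree N y z \<Longrightarrow> agree N x z"
  by (auto simp: agree_def)

lemma topspace_biinf [simp]: "topspace (biinf_topology A) = biinf A"
  by (simp add: biinf_topology_def biinf_def)

lemma compact_space_biinf: "finite A \<Longrightarrow> compact_space (biinf_topology A)"
  by (simp add: biinf_topology_def compact_space_product_topology compact_space_discrete_topology)

lemma Hausdorff_space_biinf: "Hausdorff_space (biinf_topology A)"
  by (simp add: biinf_topology_def Hausdorff_space_product_topology)

text \<open>A basic open set of the product restricts finitely many coordinates, and these lie in
  some window.\<close>

lemma openin_biinf:
  "openin (biinf_topology A) U \<longleftrightarrow>
     U \<subseteq> biinf A \<and> (\<forall>x\<in>U. \<exists>N. \<forall>y\<in>biinf A. agree N x y \<longrightarrow> y \<in> U)"  (is "?L \<longleftrightarrow> ?R")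
proof
  assume L: ?L
  then have sub: "U \<subseteq> biinf A" using openin_subset by fastforce
  moreover have "\<exists>N. \<forall>y\<in>biinf A. agree N x y \<longrightarrow> y \<in> U" if x: "x \<in> U" for x
  proof -
    obtain V where V: "finite {i. V i \<noteq> A}" "x \<in> Pi\<^sub>E UNIV V" "Pi\<^sub>E UNIV V \<subseteq> U"
      using L x unfolding biinf_topology_def openin_product_topology_alt by force
    define N where "N = Max (insert 0 ((\<lambda>i. nat \<bar>i\<bar>) ` {i. V i \<noteq> A}))"
    have N: "\<bar>i\<bar> \<le> int N" if "V i \<noteq> A" for i
    proof -
      have "nat \<bar>i\<bar> \<le> N" unfolding N_def by (rule Max_ge) (use V(1) that in auto)
      then show ?thesis by simp
    qed
    have "y \<in> U" if y: "y \<in> biinf A" "agree N x y" for y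
    proof -
      have "y i \<in> V i" for i
      proof (cases "V i = A")
        case False
        then have "y i = x i" using N y(2) by (auto simp: agree_def)
        then show ?thesis using V(2) by auto
      qed (use y(1) in \<open>auto simp: biinf_def\<close>)
      then show ?thesis using V(3) by auto
    qed
    then show ?thesis by blast
  qed
  ultimately show ?R by blast
next
  assume R: ?R
  show ?L unfolding biinf_topology_def openin_product_topology_alt
  proof (intro ballI)
    fix x assume x: "x \<in> U"
    then obtain N where N: "\<forall>y\<in>biinf A. agree N x y \<longrightarrow> y \<in> U" using R by blast
    define V where "V i = (if \<bar>i\<bar> \<le> int N then {x i} else A)" for i
    have xA: "x i \<in> A" for i using x R by (auto simp: biinf_def)
    have "finite {i\<in>UNIV. V i \<noteq> topspace (discrete_topology A)}"
      by (rule finite_subset[of _ "{- int N..int N}"]) (auto simp: V_def)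
    moreover have "Pi\<^sub>E UNIV V \<subseteq> U"
    proof
      fix y assume "y \<in> Pi\<^sub>E UNIV V"
      then have y: "y i \<in> V i" for i by auto
      then have "agree N x y" unfolding agree_def V_def by (metis singletonD)
      moreover have "y i \<in> A" for i using y[of i] xA[of i] by (auto simp: V_def split: if_splits)
      ultimately show "y \<in> U" using N by (auto simp: biinf_def)
    qed
    ultimately show "\<exists>V. finite {i\<in>UNIV. V i \<noteq> topspace (discrete_topology A)} \<and>
        (\<forall>i\<in>UNIV. openin (discrete_topology A) (V i)) \<and> x \<in> Pi\<^sub>E UNIV V \<and> Pi\<^sub>E UNIV V \<subseteq> U"
      by (intro exI[of _ V]) (use xA in \<open>auto simp: V_def\<close>)
  qed
qed

lemma closedin_biinfI:
  assumes "C \<subseteq> biinf A"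
    and "\<And>x. x \<in> biinf A \<Longrightarrow> (\<And>N. \<exists>y\<in>C. agree N x y) \<Longrightarrow> x \<in> C"
  shows "closedin (biinf_topology A) C"
  using assms unfolding closedin_def openin_biinf by simp blast

lemma closedin_biinfD:
  assumes "closedin (biinf_topology A) C" "x \<in> biinf A" "x \<notin> C"
  obtains N where "\<And>y. y \<in> C \<Longrightarrow> \<not> agree N x y"
proof -
  have "C \<subseteq> biinf A" "openin (biinf_topology A) (biinf A - C)"
    using assms(1) by (auto simp: closedin_def)
  then show ?thesis using assms(2,3) that unfolding openin_biinf by blast
qed

text \<open>A condition that only looks at a window defines a clopen set.\<close>

lemma closedin_cylinder:
  assumes "\<And>x y. x \<in> biinf A \<Longrightarrow> y \<in> biinf A \<Longrightarrow> agree N x y \<Longrightarrow> P y \<Longrightarrow> P x"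
  shows "closedin (biinf_topology A) {x \<in> biinf A. P x}"
proof (rule closedin_biinfI)
  fix x assume x: "x \<in> biinf A" "\<And>N. \<exists>y\<in>{x \<in> biinf A. P x}. agree N x y"
  then obtain y where "y \<in> biinf A" "P y" "agree N x y" by blast
  then show "x \<in> {x \<in> biinf A. P x}" using assms x(1) by blast
qed simp

lemma continuous_map_biinf:
  assumes "\<And>x. x \<in> biinf A \<Longrightarrow> f x \<in> biinf B"
    and "\<And>k. \<exists>N. \<forall>x\<in>biinf A. \<forall>y\<in>biinf A. agree N x y \<longrightarrow> f x k = f y k"
  shows "continuous_map (biinf_topology A) (biinf_topology B) f"
proof -
  have "continuous_map (biinf_topology A) (discrete_topology B) (\<lambda>x. f x k)" for k
  proof -
    obtain N where N: "\<And>x y. x \<in> biinf A \<Longrightarrow> y \<in> biinf A \<Longrightarrow> agree N x y \<Longrightarrow> f x k = f y k"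
      using assms(2) by blast
    have "f x k \<in> B" if "x \<in> biinf A" for x using assms(1)[OF that] by (auto simp: biinf_def)
    moreover have "openin (biinf_topology A) {x \<in> biinf A. f x k \<in> U}" for U
      unfolding openin_biinf using N by (metis (mono_tags, lifting) mem_Collect_eq subsetI)
    ultimately show ?thesis by (auto simp: continuous_map_def)
  qed
  then show ?thesis
    unfolding biinf_topology_def[of B] by (simp add: continuous_map_componentwise_UNIV)
qed

lemma continuous_on_subshift_iff:
  assumes "X \<subseteq> biinf A"
  shows "continuous_map (subtopology (biinf_topology A) X) euclidean g \<longleftrightarrow>
    (\<forall>x\<in>X. \<forall>e>0. \<exists>N. \<forall>y\<in>X. agree N x y \<longrightarrow> circle_norm (g y - g x) < e)"  (is "?L \<longleftrightarrow> ?R")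
proof
  assume L: ?L
  show ?R
  proof (intro ballI allI impI)
    fix x e assume x: "x \<in> X" "(e::real) > 0"
    have "openin (subtopology (biinf_topology A) X) {y \<in> X. g y \<in> {z. circle_norm (z - g x) < e}}"
      using openin_continuous_map_preimage[OF L, of "{z. circle_norm (z - g x) < e}"] assms
        open_circle_ball[of "g x" e] by (simp add: Int_absorb1)
    then obtain T where T: "openin (biinf_topology A) T"
        "{y \<in> X. g y \<in> {z. circle_norm (z - g x) < e}} = T \<inter> X"
      unfolding openin_subtopology by blast
    have "x \<in> {y \<in> X. g y \<in> {z. circle_norm (z - g x) < e}}"
      using x circle_norm_diff_self[of "g x"] by (simp del: diff_self)
    then have "x \<in> T" unfolding T(2) by blast
    then obtain N where "\<forall>y\<in>biinf A. agree N x y \<longrightarrow> y \<in> T"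
      using T(1) unfolding openin_biinf by blast
    then have "g y \<in> {z. circle_norm (z - g x) < e}" if "y \<in> X" "agree N x y" for y
      using that assms T(2) by (metis (no_types, lifting) IntI mem_Collect_eq subsetD)
    then show "\<exists>N. \<forall>y\<in>X. agree N x y \<longrightarrow> circle_norm (g y - g x) < e"
      by blast
  qed
next
  assume R: ?R
  have "openin (subtopology (biinf_topology A) X) {x \<in> X. g x \<in> U}" if U: "open U" for U
    unfolding openin_subtopology
  proof (intro exI conjI)
    let ?T = "{z \<in> biinf A. \<exists>x\<in>X. \<exists>N. agree N x z \<and> (\<forall>y\<in>X. agree N x y \<longrightarrow> g y \<in> U)}"
    show "openin (biinf_topology A) ?T"
      unfolding openin_biinf using agree_trans by blast
    have "\<exists>N. \<forall>y\<in>X. agree N x y \<longrightarrow> g y \<in> U" if x: "x \<in> X" "g x \<in> U" for x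
    proof -
      obtain e where e: "e > 0" "\<And>s. dist_int (s - rep_rmodz (g x)) < e \<Longrightarrow> rmodz s \<in> U"
        using open_circle_contains_ball[OF U, of "rep_rmodz (g x)"] x by (metis rmodz_rep)
      have "z \<in> U" if "circle_norm (z - g x) < e" for z
      proof -
        have "circle_norm (z - g x) = dist_int (rep_rmodz z - rep_rmodz (g x))"
          by (metis rmodz_rep minus_rmodz.abs_eq circle_norm.abs_eq)
        then have "rmodz (rep_rmodz z) \<in> U" using that by (intro e(2)) simp
        then show ?thesis by (simp only: rmodz_rep)
      qed
      moreover obtain N where "\<forall>y\<in>X. agree N x y \<longrightarrow> circle_norm (g y - g x) < e"
        using R x(1) e(1) by blast
      ultimately show ?thesis by blast
    qed
    then show "{x \<in> X. g x \<in> U} = ?T \<inter> X"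
      using assms agree_refl by blast
  qed
  then show ?L using assms by (simp add: continuous_map_def Int_absorb1)
qed

text \<open>The Heine--Cantor argument: finitely many cylinders, on each of which \<open>g\<close>
  stays within \<open>e / 2\<close> of its value at the centre, cover the compact subshift, and
  agreement on the largest of their windows puts two points into the same cylinder.\<close>

lemma uniformly_continuous_on_subshift:
  assumes fin: "finite A" and cl: "closedin (biinf_topology A) X"
    and g: "continuous_map (subtopology (biinf_topology A) X) euclidean g" and e: "e > 0"
  obtains N where "\<And>x y. x \<in> X \<Longrightarrow> y \<in> X \<Longrightarrow> agree N x y \<Longrightarrow> circle_norm (g x - g y) < e"
proof -
  have X: "X \<subseteq> biinf A" using closedin_subset[OF cl] by simp
  have comp: "compactin (biinf_topology A) X"
    using closedin_compact_space[OF compact_space_biinf[OF fin] cl] .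
  obtain M where M: "\<And>x y. x \<in> X \<Longrightarrow> y \<in> X \<Longrightarrow> agree (M x) x y \<Longrightarrow> circle_norm (g y - g x) < e / 2"
  proof -
    have "\<forall>x\<in>X. \<exists>N. \<forall>y\<in>X. agree N x y \<longrightarrow> circle_norm (g y - g x) < e / 2"
      using g half_gt_zero[OF e] unfolding continuous_on_subshift_iff[OF X] by blast
    from bchoice[OF this] show ?thesis using that by blast
  qed
  define U where "U x = {y \<in> biinf A. agree (M x) x y}" for x
  have "openin (biinf_topology A) (U x)" for x
    unfolding openin_biinf U_def by (auto intro: agree_trans)
  moreover have "X \<subseteq> \<Union> (U ` X)" using X by (auto simp: U_def agree_def)
  ultimately obtain \<F> where F: "finite \<F>" "\<F> \<subseteq> U ` X" "X \<subseteq> \<Union>\<F>"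
    using compactinD[OF comp, of "U ` X"] by auto
  then obtain F where F: "finite F" "F \<subseteq> X" "X \<subseteq> \<Union> (U ` F)"
    by (metis finite_subset_image)
  define N where "N = Max (insert 0 (M ` F))"
  have N: "M z \<le> N" if "z \<in> F" for z unfolding N_def by (rule Max_ge) (use F(1) that in auto)
  show ?thesis
  proof (rule that)
    fix x y assume xy: "x \<in> X" "y \<in> X" "agree N x y"
    then obtain z where z: "z \<in> F" "agree (M z) z x" using F(3) by (auto simp: U_def)
    moreover have "agree (M z) z y"
      using z agree_mono[OF xy(3) N[OF z(1)]] by (blast intro: agree_trans)
    ultimately have "circle_norm (g x - g z) < e / 2" "circle_norm (g y - g z) < e / 2"
      using M F(2) xy by auto
    then show "circle_norm (g x - g y) < e"
      using circle_norm_triangle[of "g x" "g y" "g z"] circle_norm_commute[of "g y" "g z"] by simp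
  qed
qed

section \<open>Words and factors\<close>

text \<open>The power \<open>S\<^sup>c\<close> of the shift, for every integer \<open>c\<close>.\<close>

definition translate :: "int \<Rightarrow> (int \<Rightarrow> 'a) \<Rightarrow> int \<Rightarrow> 'a" where
  "translate c x = (\<lambda>k. x (k + c))"

lemma translate_apply: "translate c x k = x (k + c)"
  by (simp add: translate_def)

lemma translate_translate [simp]: "translate c (translate d x) = translate (c + d) x"
  by (auto simp: translate_def algebra_simps)

lemma translate_0 [simp]: "translate 0 x = x"
  by (simp add: translate_def)

lemma funpow_shift: "(shift ^^ k) x = translate (int k) x"
proof (induction k)
  case (Suc k)
  have "shift y = translate 1 y" for y :: "int \<Rightarrow> 'a" by (simp add: shift_def translate_def)
  then show ?case using Suc by (simp add: add.commute)
qed simp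

lemma shift_eq_translate: "shift x = translate 1 x"
  using funpow_shift[of 1 x] by simp

lemma translate_biinf: "x \<in> biinf A \<Longrightarrow> translate c x \<in> biinf A"
  by (auto simp: biinf_def translate_apply)

lemma map_upto_lists: "x \<in> biinf A \<Longrightarrow> map x s \<in> lists A"
  by (auto simp: biinf_def PiE_iff)

lemma upto_shift: "map (\<lambda>k. k + c) [i..j] = [i + c..j + c]"
  by (rule nth_equalityI) auto

lemma map_translate: "map (translate c x) [i..j] = map x [i + c..j + c]"
  unfolding upto_shift[of c i j, symmetric] by (simp add: translate_apply)

lemma factors_translate: "factors (translate c x) = factors x"
proof -
  have "factors (translate c x) \<subseteq> factors x" for x :: "int \<Rightarrow> 'a" and c
    unfolding factors_def by (auto simp: map_translate)
  from this[of c x] this[of "- c" "translate c x"] show ?thesis by auto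
qed

lemma sublist_map_upto:
  assumes "sublist w (map x [i..j])"
  obtains p where "p \<ge> i" "w = map x [p..p + int (length w) - 1]"
proof -
  obtain u v where uv: "map x [i..j] = u @ w @ v" using assms by (auto simp: sublist_def)
  let ?p = "i + int (length u)"
  have len: "length u + length w + length v = nat (j - i + 1)"
    using arg_cong[OF uv, of length] by simp
  have "w ! k = x (?p + int k)" if "k < length w" for k
  proof -
    have "w ! k = map x [i..j] ! (length u + k)" using that by (simp add: uv nth_append)
    also have "\<dots> = x (?p + int k)" using that len by (simp add: add.assoc)
    finally show ?thesis .
  qed
  then have "w = map x [?p..?p + int (length w) - 1]" by (intro nth_equalityI) auto
  then show ?thesis by (intro that[of ?p]) auto
qed

lemma factors_sublist: "w \<in> factors x \<Longrightarrow> sublist v w \<Longrightarrow> v \<in> factors x"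
  unfolding factors_def using sublist_map_upto by (smt (verit) mem_Collect_eq)

lemma sublist_map_upto_mono:
  assumes "i' \<le> i" "j \<le> j'" shows "sublist (map x [i..j]) (map x [i'..j'])"
proof (cases "i \<le> j")
  case True
  have "[i'..j'] = [i'..i - 1] @ [i..j] @ [j + 1..j']"
    using upto_split1[of i' i j'] upto_split2[of i j j'] assms True by simp
  then have "map x [i'..j'] = map x [i'..i - 1] @ map x [i..j] @ map x [j + 1..j']" by simp
  then show ?thesis unfolding sublist_def by blast
qed auto

lemma factors_window:
  assumes "w \<in> factors x"
  obtains N where "sublist w (map x [- int N..int N])"
proof -
  obtain i j where w: "w = map x [i..j]" using assms by (auto simp: factors_def)
  show ?thesis
    by (rule that[of "nat (\<bar>i\<bar> + \<bar>j\<bar>)"]) (unfold w, rule sublist_map_upto_mono, auto)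
qed

lemma agree_window:
  "agree N x y \<longleftrightarrow> map x [- int N..int N] = map y [- int N..int N]"
  by (auto simp: agree_def abs_le_iff)

text \<open>The bound on \<open>c\<close> keeps track of where the word is found; it turns
  occurrences far to the right into statements about forward orbits.\<close>

lemma agree_translate_if_sublist:
  assumes "sublist (map x [- int N..int N]) (map z [i..j])"
  obtains c where "c \<ge> i + int N" "agree N x (translate c z)"
proof -
  obtain p where p: "p \<ge> i"
      "map x [- int N..int N] = map z [p..p + int (length (map x [- int N..int N])) - 1]"
    using sublist_map_upto[OF assms] by metis
  have "p + int (length (map x [- int N..int N])) - 1 = int N + (p + int N)"
    "p = - int N + (p + int N)" by auto
  then have "map x [- int N..int N] = map (translate (p + int N) z) [- int N..int N]"
    using p(2) unfolding map_translate by metis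
  then have "agree N x (translate (p + int N) z)" by (simp add: agree_window)
  then show ?thesis by (intro that[of "p + int N"]) (use p(1) in linarith)
qed

section \<open>Substitutions\<close>

lemma is_substitution_lists: "is_substitution A B t \<Longrightarrow> w \<in> lists A \<Longrightarrow> t w \<in> lists B"
  by (auto simp: is_substitution_def)

lemma is_substitution_append:
  "is_substitution A B t \<Longrightarrow> u \<in> lists A \<Longrightarrow> v \<in> lists A \<Longrightarrow> t (u @ v) = t u @ t v"
  by (simp add: is_substitution_def)

lemma is_substitution_Nil: "is_substitution A B t \<Longrightarrow> t [] = []"
  by (simp add: is_substitution_def)

lemma is_substitution_letter_pos: "is_substitution A B t \<Longrightarrow> a \<in> A \<Longrightarrow> 0 < length (t [a])"
  by (simp add: is_substitution_def)

lemma sublist_substitution: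
  assumes t: "is_substitution A B t" and v: "v \<in> lists A" and u: "sublist u v"
  shows "sublist (t u) (t v)"
proof -
  obtain p s where uv: "v = p @ u @ s" using u by (auto simp: sublist_def)
  then have "p \<in> lists A" "u \<in> lists A" "s \<in> lists A" using v by auto
  then have "t v = t p @ t u @ t s" using t uv by (simp add: is_substitution_append)
  then show ?thesis by (auto simp: sublist_def)
qed

lemma sublist_singleton: "sublist [a] w \<longleftrightarrow> a \<in> set w"
  by (auto simp: sublist_def in_set_conv_decomp)

lemma is_substitution_id: "is_substitution A A id"
  by (auto simp: is_substitution_def)

lemma is_substitution_comp:
  assumes s: "is_substitution B C s" and t: "is_substitution A B t"
  shows "is_substitution A C (s \<circ> t)"
  unfolding is_substitution_def
proof (intro conjI ballI)
  show "s \<circ> t \<in> lists A \<rightarrow> lists C"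
    using is_substitution_lists[OF s] is_substitution_lists[OF t] by auto
  show "(s \<circ> t) [] = []" using is_substitution_Nil[OF s] is_substitution_Nil[OF t] by simp
  show "(s \<circ> t) (u @ v) = (s \<circ> t) u @ (s \<circ> t) v" if "u \<in> lists A" "v \<in> lists A" for u v
    using that is_substitution_append[OF s] is_substitution_append[OF t]
      is_substitution_lists[OF t] by simp
next
  fix a assume a: "a \<in> A"
  then have "t [a] \<in> lists B" using is_substitution_lists[OF t] by simp
  then show "(s \<circ> t) [a] \<noteq> []"
    using is_substitution_length[OF s] is_substitution_letter_pos[OF t a] by fastforce
next
  fix c assume "c \<in> C"
  then obtain b where b: "b \<in> B" "c \<in> set (s [b])" using s by (auto simp: is_substitution_def)
  then obtain a where a: "a \<in> A" "b \<in> set (t [a])" using t by (auto simp: is_substitution_def)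
  then have "sublist (s [b]) (s (t [a]))"
    using is_substitution_lists[OF t] by (intro sublist_substitution[OF s]) (auto simp: sublist_singleton)
  then have "c \<in> set (s (t [a]))" using b(2) set_mono_sublist by blast
  then show "\<exists>a\<in>A. c \<in> set ((s \<circ> t) [a])" using a(1) by auto
qed

section \<open>Block decomposition of the image of a bi-infinite sequence\<close>

lemma cut_0 [simp]: "is_substitution A B t \<Longrightarrow> cut t x 0 = 0"
  by (simp add: cut_def is_substitution_Nil)

lemma cut_Suc:
  assumes t: "is_substitution A B t" and x: "x \<in> biinf A"
  shows "cut t x (j + 1) = cut t x j + int (length (t [x j]))"
proof -
  have app: "t (map x (s @ s')) = t (map x s) @ t (map x s')" for s s'
    using is_substitution_append[OF t] map_upto_lists[OF x] by simp
  consider "j \<ge> 0" | "j = -1" | "j < -1" by linarith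
  then show ?thesis
  proof cases
    case 1
    then have "[0..j] = [0..j - 1] @ [j]" by (rule upto_rec2)
    then show ?thesis using app[of "[0..j - 1]" "[j]"] 1 by (simp add: cut_def)
  next
    case 2
    then show ?thesis using is_substitution_Nil[OF t] by (simp add: cut_def)
  next
    case 3
    then have "[j..-1] = [j] @ [j + 1..-1]" by (simp add: upto_rec1)
    then show ?thesis using app[of "[j]" "[j + 1..-1]"] 3 by (simp add: cut_def)
  qed
qed

lemma block_pos:
  assumes "is_substitution A B t" "x \<in> biinf A"
  shows "0 < length (t [x j])"
proof -
  have "x j \<in> A" using assms(2) by (auto simp: biinf_def)
  then show ?thesis using is_substitution_letter_pos[OF assms(1)] by blast
qed

lemma cut_mono:
  assumes "is_substitution A B t" "x \<in> biinf A" "i \<le> j"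
  shows "cut t x i \<le> cut t x j"
  using assms(3)
proof (induction j rule: int_ge_induct)
  case (step j)
  then show ?case using cut_Suc[OF assms(1,2), of j] by simp
qed simp

text \<open>The blocks \<open>t (x\<^sub>j)\<close> tile the integers, so every coordinate has an
  address consisting of a block and an offset in it.\<close>

lemma cut_locate:
  assumes t: "is_substitution A B t" and x: "x \<in> biinf A"
  obtains j r where "k = cut t x j + int r" "r < length (t [x j])"
proof -
  note Suc = cut_Suc[OF t x] and pos = block_pos[OF t x]
  have "\<exists>j. cut t x j \<le> k \<and> k < cut t x (j + 1)"
  proof (induction k rule: int_induct[where k = 0])
    case base
    show ?case using Suc[of 0] pos[of 0] t by (intro exI[of _ 0]) simp
  next
    case (step1 k)
    then obtain j where j: "cut t x j \<le> k" "k < cut t x (j + 1)" by blast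
    show ?case
    proof (cases "k + 1 < cut t x (j + 1)")
      case True
      then show ?thesis using j by (intro exI[of _ j]) simp
    next
      case False
      then show ?thesis using j Suc[of "j + 1"] pos[of "j + 1"] by (intro exI[of _ "j + 1"]) linarith
    qed
  next
    case (step2 k)
    then obtain j where j: "cut t x j \<le> k" "k < cut t x (j + 1)" by blast
    show ?case
    proof (cases "cut t x j \<le> k - 1")
      case True
      then show ?thesis using j by (intro exI[of _ j]) simp
    next
      case False
      then show ?thesis using j Suc[of "j - 1"] pos[of "j - 1"] by (intro exI[of _ "j - 1"]) simp
    qed
  qed
  then obtain j where j: "cut t x j \<le> k" "k < cut t x (j + 1)" by blast
  show ?thesis by (rule that[of j "nat (k - cut t x j)"]) (use j Suc[of j] in auto)
qed

lemma subst_biinf_mem: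
  assumes t: "is_substitution A B t" and x: "x \<in> biinf A"
  shows "subst_biinf t x \<in> biinf B"
proof -
  have "subst_biinf t x k \<in> B" for k
  proof -
    obtain j r where jr: "k = cut t x j + int r" "r < length (t [x j])" by (rule cut_locate[OF t x])
    have "t [x j] \<in> lists B" using is_substitution_lists[OF t] map_upto_lists[OF x, of "[j]"] by simp
    then show ?thesis using jr subst_biinf_block[OF t x jr(2)] by (auto simp: in_lists_conv_set)
  qed
  then show ?thesis by (auto simp: biinf_def)
qed

lemma cut_translate:
  assumes t: "is_substitution A B t" and x: "x \<in> biinf A"
  shows "cut t (translate i x) j = cut t x (i + j) - cut t x i"
proof -
  have Suc: "cut t x (i + (j + 1)) = cut t x (i + j) + int (length (t [x (i + j)]))" for j
    using cut_Suc[OF t x, of "i + j"] by (simp add: add.assoc)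
  have Suc': "cut t (translate i x) (j + 1) = cut t (translate i x) j + int (length (t [x (i + j)]))"
    for j
    using cut_Suc[OF t translate_biinf[OF x, of i], of j]
    unfolding translate_apply[of i x j] by (simp only: add.commute)
  show ?thesis
  proof (induction j rule: int_induct[where k = 0])
    case base
    show ?case using t by simp
  next
    case (step1 j)
    then show ?case using Suc[of j] Suc'[of j] by linarith
  next
    case (step2 j)
    then show ?case using Suc[of "j - 1"] Suc'[of "j - 1"] by (simp)
  qed
qed

text \<open>Shifting the preimage by \<open>i\<close> letters shifts the image by the total length
  of the blocks passed. Both sides are compared on each block.\<close>

lemma subst_biinf_translate:
  assumes t: "is_substitution A B t" and x: "x \<in> biinf A"
  shows "subst_biinf t (translate i x) = translate (cut t x i) (subst_biinf t x)"
proof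
  fix k
  note x' = translate_biinf[OF x, of i]
  obtain j r where jr: "k = cut t (translate i x) j + int r" "r < length (t [translate i x j])"
    by (rule cut_locate[OF t x'])
  have "subst_biinf t (translate i x) k = t [x (j + i)] ! r"
    using subst_biinf_block[OF t x' jr(2)] unfolding jr(1) translate_apply[of i x j] .
  also have "\<dots> = subst_biinf t x (cut t x (j + i) + int r)"
    using subst_biinf_block[OF t x, of r "j + i"] jr(2) unfolding translate_apply by simp
  also have "\<dots> = translate (cut t x i) (subst_biinf t x) k"
    using jr(1) cut_translate[OF t x, of i j] translate_apply[of "cut t x i" "subst_biinf t x" k]
    by (simp add: algebra_simps)
  finally show "subst_biinf t (translate i x) k = translate (cut t x i) (subst_biinf t x) k" .
qed

lemma subst_biinf_word:
  assumes t: "is_substitution A B t" and x: "x \<in> biinf A" and ij: "i \<le> j"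
  shows "map (subst_biinf t x) [cut t x i..cut t x j - 1] = t (map x [i..j - 1])"
  using ij
proof (induction j rule: int_ge_induct)
  case base
  show ?case using is_substitution_Nil[OF t] by simp
next
  case (step j)
  let ?y = "subst_biinf t x"
  have le: "cut t x i \<le> cut t x j" using cut_mono[OF t x step(1)] .
  have "[cut t x i..cut t x (j + 1) - 1] = [cut t x i..cut t x j - 1] @ [cut t x j..cut t x (j + 1) - 1]"
    using le cut_Suc[OF t x, of j] block_pos[OF t x, of j] by (intro upto_split1) auto
  moreover have "map ?y [cut t x j..cut t x (j + 1) - 1] = t [x j]"
    using cut_Suc[OF t x, of j] subst_biinf_block[OF t x, of _ j] by (intro nth_equalityI) auto
  moreover have "[i..j] = [i..j - 1] @ [j]" using step(1) by (rule upto_rec2)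
  then have "t (map x [i..j + 1 - 1]) = t (map x [i..j - 1]) @ t [x j]"
    using is_substitution_append[OF t map_upto_lists[OF x] map_upto_lists[OF x], of "[i..j - 1]" "[j]"]
    by simp
  ultimately show ?case using step(2) by simp
qed

lemma factors_subst_biinf:
  assumes t: "is_substitution A B t" and x: "x \<in> biinf A" and w: "w \<in> factors x"
  shows "t w \<in> factors (subst_biinf t x)"
proof -
  obtain i j where w: "w = map x [i..j]" using w by (auto simp: factors_def)
  show ?thesis
  proof (cases "i \<le> j")
    case True
    then have "t w = map (subst_biinf t x) [cut t x i..cut t x (j + 1) - 1]"
      using subst_biinf_word[OF t x, of i "j + 1"] w by simp
    then show ?thesis by (auto simp: factors_def)
  next
    case False
    then have "t w = map (subst_biinf t x) [1..0]" using w is_substitution_Nil[OF t] by simp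
    then show ?thesis unfolding factors_def by blast
  qed
qed

text \<open>A finite word of the image lies inside the union of the finitely many blocks it meets.\<close>

lemma factors_subst_biinf_cover:
  assumes t: "is_substitution A B t" and x: "x \<in> biinf A" and w: "w \<in> factors (subst_biinf t x)"
  obtains v where "v \<in> factors x" "sublist w (t v)"
proof -
  obtain p q where w: "w = map (subst_biinf t x) [p..q]" using w by (auto simp: factors_def)
  obtain i r where i: "p = cut t x i + int r" "r < length (t [x i])" by (rule cut_locate[OF t x])
  obtain j s where j: "q = cut t x j + int s" "s < length (t [x j])" by (rule cut_locate[OF t x])
  let ?j = "max i (j + 1)"
  have "cut t x (j + 1) \<le> cut t x ?j" by (rule cut_mono[OF t x]) simp
  then have "sublist w (map (subst_biinf t x) [cut t x i..cut t x ?j - 1])"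
    unfolding w using i j cut_Suc[OF t x, of j] by (intro sublist_map_upto_mono) auto
  then have "sublist w (t (map x [i..?j - 1]))" by (simp add: subst_biinf_word[OF t x])
  then show ?thesis using that[of "map x [i..?j - 1]"] by (auto simp: factors_def)
qed

text \<open>Blocks are non-empty, so the letters of \<open>x\<close> with index at most
  \<open>\<bar>k\<bar>\<close> in absolute value determine coordinate \<open>k\<close> of the
  image.\<close>

lemma continuous_subst_biinf:
  assumes t: "is_substitution A B t"
  shows "continuous_map (biinf_topology A) (biinf_topology B) (\<lambda>x. translate c (subst_biinf t x))"
proof (rule continuous_map_biinf)
  show "translate c (subst_biinf t x) \<in> biinf B" if "x \<in> biinf A" for x
    using that subst_biinf_mem[OF t] translate_biinf by blast
  fix k
  have "subst_biinf t x k = subst_biinf t y k" if "agree (nat \<bar>k\<bar>) x y" for x y k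
  proof (cases "0 \<le> k")
    case True
    then have "map x [0..k] = map y [0..k]" using that by (auto simp: agree_def)
    then show ?thesis using True by (simp add: subst_biinf_def del: map_eq_conv)
  next
    case False
    then have "map x [k..-1] = map y [k..-1]" using that by (auto simp: agree_def)
    then show ?thesis using False by (simp add: subst_biinf_def Let_def del: map_eq_conv)
  qed
  then show "\<exists>N. \<forall>x\<in>biinf A. \<forall>y\<in>biinf A. agree N x y \<longrightarrow>
      translate c (subst_biinf t x) k = translate c (subst_biinf t y) k"
    unfolding translate_apply by blast
qed

section \<open>Compositions along a directive sequence\<close>

lemma comp_from_to_refl: "comp_from_to \<tau> n n = id"
  by (simp add: comp_from_to_def)

lemma comp_from_to_Suc:
  assumes "n \<le> m" shows "comp_from_to \<tau> n (Suc m) = comp_from_to \<tau> n m \<circ> \<tau> m"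
proof -
  have "foldr (\<circ>) (fs @ [f]) id = foldr (\<circ>) fs id \<circ> f" for fs and f :: "'a list \<Rightarrow> 'a list"
    by (induction fs) auto
  from this[of "map \<tau> [n..<m]" "\<tau> m"] show ?thesis
    unfolding comp_from_to_def using assms by simp
qed

lemma comp_from_to_comp:
  assumes "n \<le> m" "m \<le> p"
  shows "comp_from_to \<tau> n p = comp_from_to \<tau> n m \<circ> comp_from_to \<tau> m p"
  using assms(2)
proof (induction p rule: dec_induct)
  case (step p)
  then show ?case using assms(1) by (simp add: comp_from_to_Suc o_assoc)
qed (simp add: comp_from_to_refl)

lemma is_substitution_comp_from_to:
  assumes "directive_seq A \<tau>" "n \<le> m"
  shows "is_substitution (A m) (A n) (comp_from_to \<tau> n m)"
  using assms(2)
proof (induction m rule: dec_induct)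
  case base
  show ?case unfolding comp_from_to_refl by (rule is_substitution_id)
next
  case (step m)
  have "is_substitution (A (Suc m)) (A m) (\<tau> m)" using assms(1) by (simp add: directive_seq_def)
  from is_substitution_comp[OF step.IH this] show ?case
    unfolding comp_from_to_Suc[OF step.hyps(1)] .
qed

text \<open>Primitivity provides a single level \<open>m\<close>. It persists for all later
  levels, because the image at level \<open>m\<close> of a letter of a later level is a non-empty
  word.\<close>

lemma primitive_eventually:
  assumes ds: "directive_seq A \<tau>" and pr: "primitive A \<tau>"
  obtains m where "m > n" "\<And>p a. p \<ge> m \<Longrightarrow> a \<in> A p \<Longrightarrow> A n \<subseteq> set (comp_from_to \<tau> n p [a])"
proof -
  obtain m where m: "m > n" "\<And>a b. b \<in> A n \<Longrightarrow> a \<in> A m \<Longrightarrow> b \<in> set (comp_from_to \<tau> n m [a])"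
    using pr unfolding primitive_def by blast
  show ?thesis
  proof (rule that[OF m(1)])
    fix p a assume p: "p \<ge> m" and a: "a \<in> A p"
    note sub = is_substitution_comp_from_to[OF ds]
    let ?v = "comp_from_to \<tau> m p [a]"
    have v: "?v \<in> lists (A m)" "?v \<noteq> []"
      using is_substitution_lists[OF sub[OF p]] is_substitution_letter_pos[OF sub[OF p] a] a by auto
    then obtain c where c: "c \<in> set ?v" "c \<in> A m" by (cases ?v) auto
    have "sublist (comp_from_to \<tau> n m [c]) (comp_from_to \<tau> n m ?v)"
      using m(1) c v by (intro sublist_substitution[OF sub]) (auto simp: sublist_singleton)
    then show "A n \<subseteq> set (comp_from_to \<tau> n p [a])"
      using m c(2) p set_mono_sublist by (fastforce simp: comp_from_to_comp[of n m p])
  qed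
qed

text \<open>From a late level on, the image of every letter contains the letter \<open>a\<close>
  of level \<open>m\<close>, and hence the image of \<open>a\<close> and every word in it.\<close>

lemma sublist_comp_from_to_eventually:
  assumes ds: "directive_seq A \<tau>" and pr: "primitive A \<tau>"
    and m: "n \<le> m" "a \<in> A m" and w: "sublist w (comp_from_to \<tau> n m [a])"
  obtains q where "q > m" "\<And>p b. p \<ge> q \<Longrightarrow> b \<in> A p \<Longrightarrow> sublist w (comp_from_to \<tau> n p [b])"
proof -
  obtain q where q: "q > m" "\<And>p b. p \<ge> q \<Longrightarrow> b \<in> A p \<Longrightarrow> A m \<subseteq> set (comp_from_to \<tau> m p [b])"
    using primitive_eventually[OF ds pr] by metis
  show ?thesis
  proof (rule that[OF q(1)])
    fix p b assume pb: "p \<ge> q" "b \<in> A p"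
    then have "sublist [a] (comp_from_to \<tau> m p [b])" using q(2) m(2) by (auto simp: sublist_singleton)
    moreover have "comp_from_to \<tau> m p [b] \<in> lists (A m)"
      using is_substitution_lists[OF is_substitution_comp_from_to[OF ds], of m p] pb q(1) by simp
    ultimately have "sublist (comp_from_to \<tau> n m [a]) (comp_from_to \<tau> n m (comp_from_to \<tau> m p [b]))"
      by (intro sublist_substitution[OF is_substitution_comp_from_to[OF ds m(1)]])
    moreover have "comp_from_to \<tau> n p [b] = comp_from_to \<tau> n m (comp_from_to \<tau> m p [b])"
      using comp_from_to_comp[of n m p \<tau>] m(1) pb(1) q(1) by simp
    ultimately show "sublist w (comp_from_to \<tau> n p [b])"
      using w by (metis sublist_order.order_trans)
  qed
qed

text \<open>From a late level on, the image of a letter contains every letter of level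
  \<open>m\<close>. There are at least two of them and each has a non-empty image, so passing to
  that level lengthens the images by at least one.\<close>

lemma comp_from_to_length_unbounded:
  assumes ds: "directive_seq A \<tau>" and pr: "primitive A \<tau>"
  shows "\<exists>m>n. \<forall>p\<ge>m. \<forall>a\<in>A p. L \<le> length (comp_from_to \<tau> n p [a])"
proof (induction L)
  case 0
  show ?case by auto
next
  case (Suc L)
  note sub = is_substitution_comp_from_to[OF ds]
  obtain m where m: "m > n" "\<And>p a. p \<ge> m \<Longrightarrow> a \<in> A p \<Longrightarrow> L \<le> length (comp_from_to \<tau> n p [a])"
    using Suc by blast
  obtain q where q: "q > m" "\<And>p a. p \<ge> q \<Longrightarrow> a \<in> A p \<Longrightarrow> A m \<subseteq> set (comp_from_to \<tau> m p [a])"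
    using primitive_eventually[OF ds pr] by metis
  have "Suc L \<le> length (comp_from_to \<tau> n p [a])" if pa: "p \<ge> q" "a \<in> A p" for p a
  proof -
    let ?w = "comp_from_to \<tau> m p [a]"
    have "2 \<le> card (A m)" using ds by (simp add: directive_seq_def)
    also have "\<dots> \<le> card (set ?w)" using q(2)[OF pa] by (intro card_mono) auto
    also have "\<dots> \<le> length ?w" by (rule card_length)
    finally obtain b c r where w: "?w = b # c # r" by (cases ?w; cases "tl ?w") auto
    have "?w \<in> lists (A m)" using is_substitution_lists[OF sub, of m p "[a]"] pa q(1) by simp
    then have bcr: "b \<in> A m" "c \<in> A m" "r \<in> lists (A m)" unfolding w by auto
    have app: "comp_from_to \<tau> n m (u @ v) = comp_from_to \<tau> n m u @ comp_from_to \<tau> n m v"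
      if "u \<in> lists (A m)" "v \<in> lists (A m)" for u v
      using is_substitution_append[OF sub] that m(1) by simp
    have "comp_from_to \<tau> n p [a] = comp_from_to \<tau> n m ([b] @ [c] @ r)"
      using comp_from_to_comp[of n m p \<tau>] m(1) q(1) pa(1) w by simp
    also have "\<dots> = comp_from_to \<tau> n m [b] @ comp_from_to \<tau> n m [c] @ comp_from_to \<tau> n m r"
      using app[of "[b]" "[c] @ r"] app[of "[c]" r] bcr by simp
    finally have "length (comp_from_to \<tau> n p [a]) \<ge>
        length (comp_from_to \<tau> n m [b]) + length (comp_from_to \<tau> n m [c])" by simp
    moreover have "L \<le> length (comp_from_to \<tau> n m [b])" using m(2) bcr by simp
    moreover have "0 < length (comp_from_to \<tau> n m [c])"
      using is_substitution_letter_pos[OF sub] bcr(2) m(1) by simp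
    ultimately show ?thesis by linarith
  qed
  then show ?case using q(1) m(1) by (intro exI[of _ q]) auto
qed

section \<open>The subshifts of the levels\<close>

lemma level_shift_biinf: "x \<in> level_shift A \<tau> n \<Longrightarrow> x \<in> biinf (A n)"
  by (simp add: level_shift_def)

lemma translate_level_shift:
  "x \<in> level_shift A \<tau> n \<Longrightarrow> translate c x \<in> level_shift A \<tau> n"
  by (simp add: level_shift_def translate_biinf factors_translate)

lemma shift_level_shift: "x \<in> level_shift A \<tau> n \<Longrightarrow> shift x \<in> level_shift A \<tau> n"
  unfolding shift_eq_translate by (rule translate_level_shift)

lemma level_shift_letter: "x \<in> level_shift A \<tau> n \<Longrightarrow> x i \<in> A n"
  by (auto simp: level_shift_def biinf_def)

text \<open>Membership is a condition on finite factors, and each factor lies in a window.\<close>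

lemma closedin_level_shift: "closedin (biinf_topology (A n)) (level_shift A \<tau> n)"
proof (rule closedin_biinfI)
  show "level_shift A \<tau> n \<subseteq> biinf (A n)" using level_shift_biinf by blast
  fix x assume x: "x \<in> biinf (A n)" "\<And>N. \<exists>y\<in>level_shift A \<tau> n. agree N x y"
  have "\<exists>m>n. \<exists>a\<in>A m. sublist w (comp_from_to \<tau> n m [a])" if w: "w \<in> factors x" for w
  proof -
    obtain N where N: "sublist w (map x [- int N..int N])" using factors_window[OF w] .
    obtain y where y: "y \<in> level_shift A \<tau> n" "agree N x y" using x(2) by blast
    have "map x [- int N..int N] = map y [- int N..int N]" using y(2) by (simp only: agree_window)
    then have "map x [- int N..int N] \<in> factors y" unfolding factors_def by blast
    then have "w \<in> factors y" using N factors_sublist by blast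
    then show ?thesis using y(1) by (simp add: level_shift_def)
  qed
  then show "x \<in> level_shift A \<tau> n" using x(1) by (simp add: level_shift_def)
qed

text \<open>A compactness argument: images of letters are arbitrarily long, so for every window
  there are points whose restriction to it occurs in an image; the sets of such points are closed
  and decrease with the window, and a common point lies in the subshift.\<close>

lemma level_shift_nonempty:
  assumes ds: "directive_seq A \<tau>" and pr: "primitive A \<tau>"
  shows "level_shift A \<tau> n \<noteq> {}"
proof -
  \<comment> \<open>Points whose window of radius \<open>N\<close> occurs in the image of a letter.\<close>
  define C where "C N = {x \<in> biinf (A n). \<exists>m>n. \<exists>a\<in>A m.
      sublist (map x [- int N..int N]) (comp_from_to \<tau> n m [a])}" for N
  have ne: "A m \<noteq> {}" for m
    using ds unfolding directive_seq_def by (metis card.empty not_numeral_le_zero)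
  have "closedin (biinf_topology (A n)) (C N)" for N
    unfolding C_def by (rule closedin_cylinder[where N = N]) (simp only: agree_window)
  moreover have "C N \<noteq> {}" for N
  proof -
    obtain m where m: "m > n" "\<forall>p\<ge>m. \<forall>a\<in>A p. 2 * N + 1 \<le> length (comp_from_to \<tau> n p [a])"
      using comp_from_to_length_unbounded[OF ds pr] by blast
    obtain a where a: "a \<in> A m" using ne by blast
    let ?w = "comp_from_to \<tau> n m [a]"
    have w: "set ?w \<subseteq> A n" "2 * N + 1 \<le> length ?w"
      using is_substitution_lists[OF is_substitution_comp_from_to[OF ds], of n m "[a]"] m a by auto
    obtain b where b: "b \<in> A n" using ne by blast
    \<comment> \<open>The image \<open>?w\<close> is long enough to fill the window; the other coordinates are arbitrary.\<close>
    define x where "x i = (if \<bar>i\<bar> \<le> int N then ?w ! nat (i + int N) else b)" for i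
    have "x i \<in> A n" for i
      using b w nth_mem[of "nat (i + int N)" ?w] by (auto simp: x_def)
    moreover have "map x [- int N..int N] = take (2 * N + 1) ?w"
      using w(2) by (intro nth_equalityI) (auto simp: x_def)
    then have "sublist (map x [- int N..int N]) ?w" by (simp add: sublist_take)
    ultimately have "x \<in> C N" using m(1) a by (auto simp: C_def biinf_def)
    then show ?thesis by blast
  qed
  moreover have "decseq C"
  proof (rule decseq_SucI, rule subsetI)
    fix N x assume "x \<in> C (Suc N)"
    then show "x \<in> C N"
      using sublist_map_upto_mono[of "- int (Suc N)" "- int N" "int N" "int (Suc N)" x]
        sublist_order.order_trans unfolding C_def by fastforce
  qed
  moreover have "finite (A n)" using ds by (simp add: directive_seq_def)
  ultimately have "(\<Inter>N. C N) \<noteq> {}"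
    using compact_space_imp_nest compact_space_biinf by metis
  then obtain x where x: "\<And>N. x \<in> C N" by blast
  have "x \<in> level_shift A \<tau> n"
  proof -
    have "\<exists>m>n. \<exists>a\<in>A m. sublist w (comp_from_to \<tau> n m [a])" if w: "w \<in> factors x" for w
    proof -
      obtain N where "sublist w (map x [- int N..int N])" using factors_window[OF w] .
      then show ?thesis using x[of N] sublist_order.order_trans unfolding C_def by blast
    qed
    then show ?thesis using x[of 0] by (simp add: level_shift_def C_def)
  qed
  then show ?thesis by blast
qed

text \<open>A word of the image is covered by the image of a factor of \<open>z\<close>, and this
  factor occurs in the image of a letter of some higher level \<open>p\<close>; apply the
  substitution and compose.\<close>

lemma subst_biinf_level_shift:
  assumes ds: "directive_seq A \<tau>" and nm: "n \<le> m" and z: "z \<in> level_shift A \<tau> m"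
  shows "subst_biinf (comp_from_to \<tau> n m) z \<in> level_shift A \<tau> n"
proof -
  note t = is_substitution_comp_from_to[OF ds nm] and zb = level_shift_biinf[OF z]
  have "\<exists>p>n. \<exists>a\<in>A p. sublist w (comp_from_to \<tau> n p [a])"
    if w: "w \<in> factors (subst_biinf (comp_from_to \<tau> n m) z)" for w
  proof -
    obtain v where v: "v \<in> factors z" "sublist w (comp_from_to \<tau> n m v)"
      using factors_subst_biinf_cover[OF t zb w] .
    then obtain p a where pa: "p > m" "a \<in> A p" "sublist v (comp_from_to \<tau> m p [a])"
      using z by (auto simp: level_shift_def)
    have "comp_from_to \<tau> m p [a] \<in> lists (A m)"
      using is_substitution_lists[OF is_substitution_comp_from_to[OF ds], of m p] pa by simp
    then have "sublist (comp_from_to \<tau> n m v) (comp_from_to \<tau> n m (comp_from_to \<tau> m p [a]))"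
      using pa(3) by (rule sublist_substitution[OF t])
    moreover have "comp_from_to \<tau> n p [a] = comp_from_to \<tau> n m (comp_from_to \<tau> m p [a])"
      using comp_from_to_comp[of n m p \<tau>] nm pa(1) by simp
    ultimately have "sublist w (comp_from_to \<tau> n p [a])"
      using v(2) by (metis sublist_order.order_trans)
    moreover have "p > n" using pa(1) nm by simp
    ultimately show ?thesis using pa(2) by blast
  qed
  then show ?thesis using subst_biinf_mem[OF t zb] by (simp add: level_shift_def)
qed

section \<open>Towers\<close>

text \<open>For \<open>0 \<le> c < h\<^sub>n(y\<^sub>0)\<close> this is the point over
  \<open>y\<close> on floor \<open>c\<close> of the tower of \<open>y\<^sub>0\<close>. Other
  values of \<open>c\<close> are allowed so that the orbit of a point can be described over one
  fixed \<open>y\<close>.\<close>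

definition tower_point ::
    "(nat \<Rightarrow> 'a list \<Rightarrow> 'a list) \<Rightarrow> nat \<Rightarrow> (int \<Rightarrow> 'a) \<Rightarrow> int \<Rightarrow> int \<Rightarrow> 'a" where
  "tower_point \<tau> n y c = translate c (subst_biinf (comp_from_to \<tau> 0 n) y)"

lemma shift_base_eq:
  "(shift ^^ k) ` base A \<tau> n a = {tower_point \<tau> n y (int k) | y. y \<in> level_shift A \<tau> n \<and> y 0 = a}"
  unfolding base_def image_image funpow_shift tower_point_def by blast

text \<open>A floor is the image of a compact set under a continuous map into a Hausdorff space.\<close>

lemma closedin_shift_base:
  assumes ds: "directive_seq A \<tau>"
  shows "closedin (biinf_topology (A 0)) ((shift ^^ k) ` base A \<tau> n a)"
proof -
  note t = is_substitution_comp_from_to[OF ds, of 0 n, simplified]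
  have fin: "finite (A n)" using ds by (simp add: directive_seq_def)
  have "closedin (biinf_topology (A n)) {y \<in> biinf (A n). y 0 = a}"
    by (rule closedin_cylinder[where N = 0]) (auto simp: agree_def)
  then have "closedin (biinf_topology (A n)) (level_shift A \<tau> n \<inter> {y \<in> biinf (A n). y 0 = a})"
    by (intro closedin_Int closedin_level_shift)
  then have "compactin (biinf_topology (A n)) (level_shift A \<tau> n \<inter> {y \<in> biinf (A n). y 0 = a})"
    by (rule closedin_compact_space[OF compact_space_biinf[OF fin]])
  from image_compactin[OF this continuous_subst_biinf[OF t]]
  have "compactin (biinf_topology (A 0)) ((\<lambda>y. tower_point \<tau> n y (int k)) `
      (level_shift A \<tau> n \<inter> {y \<in> biinf (A n). y 0 = a}))"
    by (simp add: tower_point_def)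
  moreover have "(\<lambda>y. tower_point \<tau> n y (int k)) ` (level_shift A \<tau> n \<inter> {y \<in> biinf (A n). y 0 = a})
      = (shift ^^ k) ` base A \<tau> n a"
    unfolding shift_base_eq using level_shift_biinf by fastforce
  ultimately show ?thesis using compactin_imp_closedin[OF Hausdorff_space_biinf] by metis
qed

text \<open>A point far along the orbit over \<open>y\<close> lies on floor \<open>r\<close> of
  the tower of \<open>y\<^sub>j\<close>, where \<open>(j, r)\<close> is the address of its
  coordinate.\<close>

lemma tower_point_locate:
  assumes ds: "directive_seq A \<tau>" and y: "y \<in> level_shift A \<tau> n"
  obtains j r where "c = cut (comp_from_to \<tau> 0 n) y j + int r" "r < height \<tau> n [y j]"
    "tower_point \<tau> n y c = tower_point \<tau> n (translate j y) (int r)"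
proof -
  note t = is_substitution_comp_from_to[OF ds, of 0 n, simplified] and yb = level_shift_biinf[OF y]
  obtain j r where jr: "c = cut (comp_from_to \<tau> 0 n) y j + int r"
      "r < length (comp_from_to \<tau> 0 n [y j])"
    by (rule cut_locate[OF t yb])
  show ?thesis
    by (rule that[OF jr(1)])
      (use jr in \<open>simp_all add: height_def tower_point_def subst_biinf_translate[OF t yb] add.commute\<close>)
qed

text \<open>By primitivity, every finite window of a point appears in the images of all letters of
  all sufficiently high levels.\<close>

lemma level_shift_window:
  assumes ds: "directive_seq A \<tau>" and pr: "primitive A \<tau>" and x: "x \<in> level_shift A \<tau> n"
  obtains q where "\<And>p b. p \<ge> q \<Longrightarrow> b \<in> A p \<Longrightarrow>
    sublist (map x [- int N..int N]) (comp_from_to \<tau> n p [b])"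
proof -
  have "map x [- int N..int N] \<in> factors x" unfolding factors_def by blast
  then obtain m a where m: "m > n" "a \<in> A m"
      "sublist (map x [- int N..int N]) (comp_from_to \<tau> n m [a])"
    using x unfolding level_shift_def by blast
  show ?thesis
    by (rule sublist_comp_from_to_eventually[OF ds pr less_imp_le[OF m(1)] m(2,3)]) (rule that)
qed

text \<open>The window of \<open>x\<close> is found inside the block of \<open>z\<^sub>1\<close>,
  hence at or beyond the end of the block of \<open>z\<^sub>0\<close>. So it is met in the future
  of every point of the tower of \<open>z\<^sub>0\<close>.\<close>

lemma tower_point_follows:
  assumes ds: "directive_seq A \<tau>" and pr: "primitive A \<tau>" and x: "x \<in> level_shift A \<tau> 0"
  obtains q where "\<And>p z. p \<ge> q \<Longrightarrow> z \<in> level_shift A \<tau> p \<Longrightarrow>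
    \<exists>c \<ge> int (height \<tau> p [z 0]). agree N x (tower_point \<tau> p z c)"
proof -
  obtain q where q: "\<And>p b. p \<ge> q \<Longrightarrow> b \<in> A p \<Longrightarrow>
      sublist (map x [- int N..int N]) (comp_from_to \<tau> 0 p [b])"
    by (rule level_shift_window[OF ds pr x, of N]) blast
  show ?thesis
  proof (rule that)
    fix p z assume p: "p \<ge> q" and z: "z \<in> level_shift A \<tau> p"
    note t = is_substitution_comp_from_to[OF ds, of 0 p, simplified] and zb = level_shift_biinf[OF z]
    let ?t = "comp_from_to \<tau> 0 p"
    have "sublist (map x [- int N..int N]) (?t [z 1])" using q[OF p] level_shift_letter[OF z] .
    also have "?t [z 1] = map (subst_biinf ?t z) [cut ?t z 1..cut ?t z 2 - 1]"
      using subst_biinf_word[OF t zb, of 1 2] by simp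
    finally obtain c where c: "c \<ge> cut ?t z 1 + int N" "agree N x (translate c (subst_biinf ?t z))"
      using agree_translate_if_sublist by blast
    have "cut ?t z 1 = int (height \<tau> p [z 0])" using cut_Suc[OF t zb, of 0] t by (simp add: height_def)
    then show "\<exists>c \<ge> int (height \<tau> p [z 0]). agree N x (tower_point \<tau> p z c)"
      using c by (intro exI[of _ c]) (simp add: tower_point_def)
  qed
qed

lemma closedin_towers:
  assumes ds: "directive_seq A \<tau>"
    and I: "I \<subseteq> (SIGMA a:A n. {..<height \<tau> n [a]})"
  shows "closedin (biinf_topology (A 0)) (\<Union>(a, k)\<in>I. (shift ^^ k) ` base A \<tau> n a)"
proof (rule closedin_Union)
  have "finite (A n)" using ds by (simp add: directive_seq_def)
  then have "finite (SIGMA a:A n. {..<height \<tau> n [a]})" by (intro finite_SigmaI) auto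
  then show "finite ((\<lambda>(a, k). (shift ^^ k) ` base A \<tau> n a) ` I)"
    using I finite_subset by blast
qed (auto intro: closedin_shift_base[OF ds])

text \<open>Every point of the subshift can be desubstituted. The union of all floors is closed,
  so it suffices to approximate a given point by points on floors. Take any point \<open>z\<close>
  of a level so high that the image of each letter contains a given window, and map it down to
  level \<open>n\<close>: the orbit over this point of level \<open>n\<close> shows the window and
  consists of points on floors.\<close>

lemma level_shift_towers:
  assumes ds: "directive_seq A \<tau>" and pr: "primitive A \<tau>" and x: "x \<in> level_shift A \<tau> 0"
  obtains y k where "y \<in> level_shift A \<tau> n" "k < height \<tau> n [y 0]" "x = tower_point \<tau> n y (int k)"
proof -
  let ?Y = "\<Union>(a, k)\<in>(SIGMA a:A n. {..<height \<tau> n [a]}). (shift ^^ k) ` base A \<tau> n a"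
  have "x \<in> ?Y"
  proof (rule ccontr)
    assume "x \<notin> ?Y"
    then obtain N where N: "\<And>y. y \<in> ?Y \<Longrightarrow> \<not> agree N x y"
      using closedin_biinfD[OF closedin_towers[OF ds subset_refl] level_shift_biinf[OF x]] by metis
    obtain q where q: "\<And>p b. p \<ge> q \<Longrightarrow> b \<in> A p \<Longrightarrow>
        sublist (map x [- int N..int N]) (comp_from_to \<tau> 0 p [b])"
      by (rule level_shift_window[OF ds pr x, of N]) blast
    let ?p = "max q n"
    obtain z where z: "z \<in> level_shift A \<tau> ?p" using level_shift_nonempty[OF ds pr] by blast
    \<comment> \<open>The window of \<open>x\<close> appears in the block of \<open>z 0\<close>, viewed through level \<open>n\<close>.\<close>
    define y where "y = subst_biinf (comp_from_to \<tau> n ?p) z"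
    have y: "y \<in> level_shift A \<tau> n"
      unfolding y_def by (rule subst_biinf_level_shift[OF ds _ z]) simp
    have "map z [0..0] \<in> factors z" unfolding factors_def by blast
    then have "[z 0] \<in> factors z" by simp
    then have "comp_from_to \<tau> n ?p [z 0] \<in> factors y"
      unfolding y_def using level_shift_biinf[OF z]
      by (intro factors_subst_biinf[OF is_substitution_comp_from_to[OF ds]]) auto
    then have "comp_from_to \<tau> 0 n (comp_from_to \<tau> n ?p [z 0]) \<in> factors (subst_biinf (comp_from_to \<tau> 0 n) y)"
      using level_shift_biinf[OF y]
      by (intro factors_subst_biinf[OF is_substitution_comp_from_to[OF ds]]) auto
    moreover have "comp_from_to \<tau> 0 ?p = comp_from_to \<tau> 0 n \<circ> comp_from_to \<tau> n ?p"
      by (rule comp_from_to_comp) auto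
    ultimately have "comp_from_to \<tau> 0 ?p [z 0] \<in> factors (subst_biinf (comp_from_to \<tau> 0 n) y)"
      by simp
    moreover have "sublist (map x [- int N..int N]) (comp_from_to \<tau> 0 ?p [z 0])"
      using q[of ?p "z 0"] level_shift_letter[OF z] by simp
    ultimately obtain c where c: "agree N x (tower_point \<tau> n y c)"
      unfolding factors_def tower_point_def using agree_translate_if_sublist
      by (smt (verit) mem_Collect_eq)
    obtain j r where jr: "r < height \<tau> n [y j]"
        "tower_point \<tau> n y c = tower_point \<tau> n (translate j y) (int r)"
      using tower_point_locate[OF ds y] .
    have "tower_point \<tau> n y c \<in> (shift ^^ r) ` base A \<tau> n (y j)"
      unfolding shift_base_eq using translate_level_shift[OF y, of j] jr(2)
      by (auto simp: translate_apply intro!: exI[of _ "translate j y"])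
    moreover have "y j \<in> A n" using level_shift_letter[OF y] .
    ultimately have "tower_point \<tau> n y c \<in> ?Y" using jr(1) by auto
    then show False using N c by blast
  qed
  then show ?thesis using that unfolding shift_base_eq by auto
qed

text \<open>Minimality of the subshift, in the form that is needed: locate \<open>x0\<close> in a
  tower of a high level; the next block in its future shows the window of \<open>x\<close>.\<close>

lemma dense_forward_orbit:
  assumes ds: "directive_seq A \<tau>" and pr: "primitive A \<tau>"
    and x0: "x0 \<in> level_shift A \<tau> 0" and x: "x \<in> level_shift A \<tau> 0"
  shows "\<exists>k. agree N x ((shift ^^ k) x0)"
proof -
  obtain q where q: "\<And>p z. p \<ge> q \<Longrightarrow> z \<in> level_shift A \<tau> p \<Longrightarrow>
      \<exists>c \<ge> int (height \<tau> p [z 0]). agree N x (tower_point \<tau> p z c)"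
    by (rule tower_point_follows[OF ds pr x, of N]) blast
  obtain z k where z: "z \<in> level_shift A \<tau> q" "k < height \<tau> q [z 0]" "x0 = tower_point \<tau> q z (int k)"
    using level_shift_towers[OF ds pr x0] .
  obtain c where c: "c \<ge> int (height \<tau> q [z 0])" "agree N x (tower_point \<tau> q z c)"
    using q[OF order_refl z(1)] by blast
  have "(shift ^^ nat (c - int k)) x0 = tower_point \<tau> q z c"
    using c(1) z(2,3) by (simp add: funpow_shift tower_point_def)
  then show ?thesis using c(2) by metis
qed

text \<open>Prescribing a value for each floor defines a function on the subshift since floors are
  disjoint. It is locally constant since the complement of a floor is a finite union of closed
  floors. This is where recognizability enters.\<close>

lemma tower_function:
  assumes ds: "directive_seq A \<tau>" and pr: "primitive A \<tau>" and rec: "recognizable A \<tau>" and n: "n \<ge> 1"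
  obtains G where "\<And>y k. y \<in> level_shift A \<tau> n \<Longrightarrow> k < height \<tau> n [y 0] \<Longrightarrow>
      G (tower_point \<tau> n y (int k)) = f (y 0) k"
    and "\<And>x. x \<in> level_shift A \<tau> 0 \<Longrightarrow>
      \<exists>N. \<forall>x'\<in>level_shift A \<tau> 0. agree N x x' \<longrightarrow> G x' = G x"
proof -
  define I where "I = (SIGMA a:A n. {..<height \<tau> n [a]})"
  define B where "B = (\<lambda>(a, k). (shift ^^ k) ` base A \<tau> n a)"
  define P where "P x = (SOME i. i \<in> I \<and> x \<in> B i)" for x
  have disj: "disjoint_family_on B I" using rec n unfolding recognizable_def I_def B_def by blast
  have P: "P x = i" if "i \<in> I" "x \<in> B i" for x i
  proof -
    have "P x \<in> I \<and> x \<in> B (P x)" unfolding P_def by (rule someI[of _ i]) (use that in blast)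
    then show ?thesis using disjoint_family_onD[OF disj, of "P x" i] that by blast
  qed
  have mem: "(y 0, k) \<in> I" "tower_point \<tau> n y (int k) \<in> B (y 0, k)"
    if "y \<in> level_shift A \<tau> n" "k < height \<tau> n [y 0]" for y k
    using that level_shift_letter[OF that(1)] unfolding I_def B_def prod.case shift_base_eq by auto
  show ?thesis
  proof (rule that[of "\<lambda>x. case_prod f (P x)"])
    fix y k assume yk: "y \<in> level_shift A \<tau> n" "k < height \<tau> n [y 0]"
    show "case_prod f (P (tower_point \<tau> n y (int k))) = f (y 0) k"
      using P[OF mem[OF yk]] by simp
  next
    fix x assume x: "x \<in> level_shift A \<tau> 0"
    obtain i where i: "i \<in> I" "x \<in> B i" using level_shift_towers[OF ds pr x] mem by metis
    have "x \<notin> \<Union> (B ` (I - {i}))" using P i by blast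
    moreover have "closedin (biinf_topology (A 0)) (\<Union> (B ` (I - {i})))"
      unfolding B_def by (rule closedin_towers[OF ds]) (auto simp: I_def)
    ultimately obtain N where N: "\<And>x'. x' \<in> \<Union> (B ` (I - {i})) \<Longrightarrow> \<not> agree N x x'"
      using closedin_biinfD level_shift_biinf[OF x] by metis
    have "P x' = P x" if x': "x' \<in> level_shift A \<tau> 0" "agree N x x'" for x'
    proof -
      obtain i' where i': "i' \<in> I" "x' \<in> B i'" using level_shift_towers[OF ds pr x'(1)] mem by metis
      then have "i' = i" using N[of x'] x'(2) by blast
      then show ?thesis using P i i' by simp
    qed
    then show "\<exists>N. \<forall>x'\<in>level_shift A \<tau> 0. agree N x x' \<longrightarrow> case_prod f (P x') = case_prod f (P x)"
      by (intro exI[of _ N]) simp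
  qed
qed

section \<open>Return defects\<close>

text \<open>The errors in the eigenvalue equation for values \<open>r a\<close> assigned to the
  bases of the towers of level \<open>n\<close>, taken over all orbit segments that start and end
  in bases.\<close>

definition return_defects ::
    "(nat \<Rightarrow> 'a set) \<Rightarrow> (nat \<Rightarrow> 'a list \<Rightarrow> 'a list) \<Rightarrow> real \<Rightarrow> nat \<Rightarrow> ('a \<Rightarrow> real) \<Rightarrow> real set" where
  "return_defects A \<tau> \<alpha> n r =
     {dist_int (r (u ! 0) - r (u ! k) + \<alpha> * real (height \<tau> n (take k u))) | u k.
        u \<in> lang (level_shift A \<tau> n) \<and> set u \<subseteq> A n \<and> length u = Suc k}"

text \<open>Each word of the language starts at coordinate 0 of some point, as the subshift is
  invariant under translations.\<close>

lemma return_defects_eq: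
  "return_defects A \<tau> \<alpha> n r =
     {dist_int (r (y 0) - r (y (int k)) + \<alpha> * real (height \<tau> n (map y [0..int k - 1]))) | y k.
        y \<in> level_shift A \<tau> n}"  (is "_ = ?R")
proof (intro equalityI subsetI)
  fix d assume "d \<in> return_defects A \<tau> \<alpha> n r"
  then obtain u k x i j where d: "d = dist_int (r (u ! 0) - r (u ! k) + \<alpha> * real (height \<tau> n (take k u)))"
    and x: "x \<in> level_shift A \<tau> n" and u: "u = map x [i..j]" "length u = Suc k"
    unfolding return_defects_def lang_def factors_def by blast
  have j: "j = i + int k" using u by simp
  have "u = map (translate i x) [0..int k]" by (simp add: u(1) j map_translate add.commute)
  moreover from this have "take k u = map (translate i x) [0..int k - 1]"
    by (intro nth_equalityI) auto
  moreover have "u ! 0 = translate i x 0" "u ! k = translate i x (int k)"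
    using calculation(1) by (simp_all del: translate_translate)
  ultimately show "d \<in> ?R" using d translate_level_shift[OF x, of i] by auto
next
  fix d assume "d \<in> ?R"
  then obtain y k where d: "d = dist_int (r (y 0) - r (y (int k)) + \<alpha> * real (height \<tau> n (map y [0..int k - 1])))"
    and y: "y \<in> level_shift A \<tau> n" by blast
  let ?u = "map y [0..int k]"
  have "take k ?u = map y [0..int k - 1]" "?u ! 0 = y 0" "?u ! k = y (int k)" "length ?u = Suc k"
    by (auto intro!: nth_equalityI)
  moreover have "?u \<in> lang (level_shift A \<tau> n)" using y unfolding lang_def factors_def by blast
  moreover have "set ?u \<subseteq> A n" using level_shift_letter[OF y] by auto
  ultimately show "d \<in> return_defects A \<tau> \<alpha> n r"
    unfolding return_defects_def d by (smt (verit, best) mem_Collect_eq)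
qed

lemma bdd_above_return_defects: "bdd_above (return_defects A \<tau> \<alpha> n r)"
  by (rule bdd_aboveI[of _ 1]) (auto simp: return_defects_eq dist_int_le_1)

lemma tower_point_return:
  assumes ds: "directive_seq A \<tau>" and y: "y \<in> level_shift A \<tau> n"
  shows "tower_point \<tau> n y (int (height \<tau> n (map y [0..int k - 1]))) = tower_point \<tau> n (translate (int k) y) 0"
proof -
  note t = is_substitution_comp_from_to[OF ds, of 0 n, simplified]
  show ?thesis
    unfolding tower_point_def subst_biinf_translate[OF t level_shift_biinf[OF y]]
    by (simp add: cut_def height_def)
qed

section \<open>From eigenfunctions to small return defects\<close>

lemma eigenfunction_funpow:
  fixes g :: "(int \<Rightarrow> 'a) \<Rightarrow> rmodz"
  assumes "\<forall>x\<in>X. shift x \<in> X \<and> g (shift x) = g x + rmodz \<alpha>" "x \<in> X"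
  shows "(shift ^^ k) x \<in> X \<and> g ((shift ^^ k) x) = g x + rmodz (\<alpha> * real k)"
proof (induction k)
  case 0
  have "rmodz 0 = 0" by (simp add: zero_rmodz_def)
  then show ?case using assms(2) by simp
next
  case (Suc k)
  have "rmodz (\<alpha> * real (Suc k)) = rmodz (\<alpha> * real k) + rmodz \<alpha>"
    by (simp add: plus_rmodz.abs_eq algebra_simps)
  then show ?case using Suc assms(1) by (simp add: add.assoc)
qed

text \<open>Values of an eigenfunction are compared after \<open>N\<close> shifts, which change
  both by the same amount. Therefore agreement on the right of the origin suffices, although
  continuity refers to two-sided windows.\<close>

lemma eigenfunction_near:
  fixes g :: "(int \<Rightarrow> 'a) \<Rightarrow> rmodz"
  assumes fin: "finite A" and cl: "closedin (biinf_topology A) X"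
    and cont: "continuous_map (subtopology (biinf_topology A) X) euclidean g"
    and eig: "\<forall>x\<in>X. shift x \<in> X \<and> g (shift x) = g x + rmodz \<alpha>"
    and e: "e > 0"
  obtains L where "\<And>x y. x \<in> X \<Longrightarrow> y \<in> X \<Longrightarrow> (\<And>i. 0 \<le> i \<Longrightarrow> i < int L \<Longrightarrow> x i = y i) \<Longrightarrow>
    circle_norm (g x - g y) < e"
proof -
  obtain N where N: "\<And>x y. x \<in> X \<Longrightarrow> y \<in> X \<Longrightarrow> agree N x y \<Longrightarrow> circle_norm (g x - g y) < e"
    using uniformly_continuous_on_subshift[OF fin cl cont e] by blast
  \<comment> \<open>The translate of the interval \<open>[0, 2N]\<close> by \<open>-N\<close> is the window \<open>[-N, N]\<close>.\<close>
  show ?thesis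
  proof (rule that[of "2 * N + 1"])
    fix x y assume x: "x \<in> X" and y: "y \<in> X"
      and eq: "\<And>i. 0 \<le> i \<Longrightarrow> i < int (2 * N + 1) \<Longrightarrow> x i = y i"
    note px = eigenfunction_funpow[OF eig x, of N] and py = eigenfunction_funpow[OF eig y, of N]
    have "agree N ((shift ^^ N) x) ((shift ^^ N) y)"
      unfolding agree_def funpow_shift translate_apply by (intro allI impI eq) auto
    then have "circle_norm (g ((shift ^^ N) x) - g ((shift ^^ N) y)) < e" using N px py by blast
    then show "circle_norm (g x - g y) < e" using px py by simp
  qed
qed

text \<open>Along an orbit segment from the base of \<open>y\<^sub>0\<close> to the base of
  \<open>y\<^sub>k\<close> an eigenfunction satisfies the equation exactly. Replacing the two end
  points by the chosen points of the bases costs little, as an eigenfunction is almost constant on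
  each base of a high level.\<close>

lemma return_defects_small_if_eigenvalue:
  assumes ds: "directive_seq A \<tau>" and pr: "primitive A \<tau>"
    and ev: "continuous_eigenvalue (A 0) (level_shift A \<tau> 0) \<alpha>"
  obtains \<rho> where "(\<lambda>n. Sup (return_defects A \<tau> \<alpha> n (\<rho> n))) \<longlonglongrightarrow> 0"
proof -
  let ?X = "level_shift A \<tau> 0"
  obtain g where g: "continuous_map (subtopology (biinf_topology (A 0)) ?X) euclidean g"
      "\<forall>x\<in>?X. g (shift x) = g x + rmodz \<alpha>"
    using ev unfolding continuous_eigenvalue_def by blast
  have fin: "finite (A 0)" using ds by (simp add: directive_seq_def)
  have eig: "\<forall>x\<in>?X. shift x \<in> ?X \<and> g (shift x) = g x + rmodz \<alpha>"
    using g(2) by (simp add: shift_level_shift)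
  \<comment> \<open>One point of the level subshift for each letter; arbitrary for letters that occur in no point,
    which do not contribute to the defects.\<close>
  define pt where "pt n a = (SOME y. y \<in> level_shift A \<tau> n \<and> y 0 = a)" for n a
  have pt: "pt n (y i) \<in> level_shift A \<tau> n \<and> pt n (y i) 0 = y i" if "y \<in> level_shift A \<tau> n" for n y i
    unfolding pt_def
    by (rule someI[of _ "translate i y"]) (simp add: translate_level_shift[OF that] translate_apply)
  have base: "tower_point \<tau> n y 0 \<in> ?X" if "y \<in> level_shift A \<tau> n" for y n
    using subst_biinf_level_shift[OF ds _ that, of 0] by (simp add: tower_point_def)
  define \<rho> where "\<rho> n a = rep_rmodz (g (tower_point \<tau> n (pt n a) 0))" for n a
  have \<rho>: "rmodz (\<rho> n a) = g (tower_point \<tau> n (pt n a) 0)" for n a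
    unfolding \<rho>_def by (rule rmodz_rep)
  have "\<exists>m. \<forall>n\<ge>m. \<bar>Sup (return_defects A \<tau> \<alpha> n (\<rho> n))\<bar> < e" if e: "e > 0" for e :: real
  proof -
    obtain L where L: "\<And>x y. x \<in> ?X \<Longrightarrow> y \<in> ?X \<Longrightarrow> (\<And>i. 0 \<le> i \<Longrightarrow> i < int L \<Longrightarrow> x i = y i) \<Longrightarrow>
        circle_norm (g x - g y) < e / 3"
      using eigenfunction_near[OF fin closedin_level_shift g(1) eig, of "e / 3"] e by auto
    obtain m where m: "\<And>n a. n \<ge> m \<Longrightarrow> a \<in> A n \<Longrightarrow> L \<le> length (comp_from_to \<tau> 0 n [a])"
      using comp_from_to_length_unbounded[OF ds pr, of 0 L] by blast
    have "\<bar>Sup (return_defects A \<tau> \<alpha> n (\<rho> n))\<bar> < e" if n: "n \<ge> m" for n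
    proof -
      note t = is_substitution_comp_from_to[OF ds, of 0 n, simplified]
      have near: "circle_norm (g (tower_point \<tau> n (pt n (y 0)) 0) - g (tower_point \<tau> n y 0)) < e / 3"
        if y: "y \<in> level_shift A \<tau> n" for y
      proof (rule L)
        \<comment> \<open>Both points begin with the image of the letter \<open>y 0\<close>, which has at least \<open>L\<close> letters.\<close>
      show "tower_point \<tau> n (pt n (y 0)) 0 \<in> ?X" "tower_point \<tau> n y 0 \<in> ?X"
          using base pt[OF y] y by auto
        fix i assume i: "0 \<le> i" "i < int L"
        have "tower_point \<tau> n z 0 i = comp_from_to \<tau> 0 n [y 0] ! nat i"
          if z: "z \<in> level_shift A \<tau> n" "z 0 = y 0" for z
        proof -
          have "nat i < length (comp_from_to \<tau> 0 n [z 0])"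
            using m[OF n level_shift_letter[OF z(1), of 0]] i by simp
          from subst_biinf_block[OF t level_shift_biinf[OF z(1)] this] show ?thesis
            using i z(2) t by (simp add: tower_point_def)
        qed
        then show "tower_point \<tau> n (pt n (y 0)) 0 i = tower_point \<tau> n y 0 i"
          using pt[OF y, of 0] y by simp
      qed
      have bound: "d \<le> 2 * (e / 3)" if d: "d \<in> return_defects A \<tau> \<alpha> n (\<rho> n)" for d
      proof -
        obtain y k where d: "d = dist_int (\<rho> n (y 0) - \<rho> n (y (int k)) +
              \<alpha> * real (height \<tau> n (map y [0..int k - 1])))" and y: "y \<in> level_shift A \<tau> n"
          using d unfolding return_defects_eq by blast
        let ?h = "height \<tau> n (map y [0..int k - 1])" and ?y = "translate (int k) y"
        let ?p = "\<lambda>z. g (tower_point \<tau> n z 0)"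
        have y': "?y \<in> level_shift A \<tau> n" "?y 0 = y (int k)"
          using translate_level_shift[OF y] by (auto simp: translate_apply)
        have "(shift ^^ ?h) (tower_point \<tau> n y 0) = tower_point \<tau> n ?y 0"
          using tower_point_return[OF ds y, of k] by (simp add: funpow_shift tower_point_def)
        then have ret: "?p ?y = ?p y + rmodz (\<alpha> * real ?h)"
          using eigenfunction_funpow[OF eig base[OF y], of ?h] by simp
        have "d = circle_norm (?p (pt n (y 0)) - ?p (pt n (?y 0)) + rmodz (\<alpha> * real ?h))"
          unfolding d y'(2) \<rho>[symmetric]
          by (simp only: minus_rmodz.abs_eq plus_rmodz.abs_eq circle_norm.abs_eq)
        also have "?p (pt n (y 0)) - ?p (pt n (?y 0)) + rmodz (\<alpha> * real ?h)
            = (?p (pt n (y 0)) - ?p y) + (?p ?y - ?p (pt n (?y 0)))"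
          by (simp add: ret)
        also have "circle_norm \<dots> \<le> circle_norm (?p (pt n (y 0)) - ?p y) + circle_norm (?p ?y - ?p (pt n (?y 0)))"
          by (rule circle_norm_add)
        finally show ?thesis
          using near[OF y] near[OF y'(1)] circle_norm_commute[of "?p ?y" "?p (pt n (?y 0))"] by simp
      qed
      obtain y where "y \<in> level_shift A \<tau> n" using level_shift_nonempty[OF ds pr] by blast
      then obtain d where d: "d \<in> return_defects A \<tau> \<alpha> n (\<rho> n)" unfolding return_defects_eq by blast
      have "0 \<le> d" using d by (auto simp: return_defects_eq dist_int_nonneg)
      also have "d \<le> Sup (return_defects A \<tau> \<alpha> n (\<rho> n))"
        by (rule cSup_upper[OF d bdd_above_return_defects])
      finally have "0 \<le> Sup (return_defects A \<tau> \<alpha> n (\<rho> n))" .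
      moreover have "Sup (return_defects A \<tau> \<alpha> n (\<rho> n)) \<le> 2 * (e / 3)"
        by (rule cSup_least) (use d bound in auto)
      ultimately show ?thesis using e by linarith
    qed
    then show ?thesis by blast
  qed
  then have "(\<lambda>n. Sup (return_defects A \<tau> \<alpha> n (\<rho> n))) \<longlonglongrightarrow> 0" by (simp add: LIMSEQ_iff)
  then show ?thesis by (rule that)
qed

section \<open>From small return defects to eigenfunctions\<close>

text \<open>The value of the eigenfunction at \<open>x\<close> is read off along the orbit of
  \<open>x0\<close>: whenever \<open>S\<^sup>k x0\<close> is close to \<open>x\<close>, it must be
  close to \<open>k \<alpha>\<close>. Choosing one limit point of these numbers modulo 1 gives a
  value that fits all \<open>G n\<close> simultaneously, so no convergence of the functions
  \<open>G n\<close> themselves has to be proved.\<close>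

lemma continuous_eigenvalue_if_approximations:
  fixes G :: "nat \<Rightarrow> (int \<Rightarrow> 'a) \<Rightarrow> real"
  assumes X: "X \<subseteq> biinf A" and x0: "x0 \<in> X" and inv: "\<And>x. x \<in> X \<Longrightarrow> shift x \<in> X"
    and dense: "\<And>x N. x \<in> X \<Longrightarrow> \<exists>k. agree N x ((shift ^^ k) x0)"
    and loc: "\<And>n x. x \<in> X \<Longrightarrow> \<exists>N. \<forall>x'\<in>X. agree N x x' \<longrightarrow> G n x' = G n x"
    and almost: "\<And>n x k. x \<in> X \<Longrightarrow> dist_int (G n ((shift ^^ k) x) - G n x - \<alpha> * real k) \<le> \<epsilon> n"
    and \<epsilon>: "\<epsilon> \<longlonglongrightarrow> 0"
  shows "continuous_eigenvalue A X \<alpha>"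
proof -
  have orbit: "(shift ^^ k) x0 \<in> X" for k by (induction k) (use x0 inv in auto)
  have "\<exists>t. \<forall>n. dist_int (G n x - G n x0 - t) \<le> \<epsilon> n" if x: "x \<in> X" for x
  proof -
    obtain k where k: "\<And>N. agree N x ((shift ^^ k N) x0)" using dense[OF x] by metis
    \<comment> \<open>Fractional parts bring the numbers \<open>k \<alpha>\<close> into a compact interval without changing them modulo 1.\<close>
    have "\<forall>N. frac (\<alpha> * real (k N)) \<in> {0..1}" using frac_ge_0 frac_lt_1 less_imp_le by auto
    then obtain t s where ts: "strict_mono s" "((\<lambda>N. frac (\<alpha> * real (k N))) \<circ> s) \<longlonglongrightarrow> t"
      using compact_Icc[of "0::real" 1] unfolding compact_def by meson
    have "dist_int (G n x - G n x0 - t) \<le> \<epsilon> n" for n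
    proof -
      obtain N where N: "\<forall>x'\<in>X. agree N x x' \<longrightarrow> G n x' = G n x" using loc[OF x] by blast
      have "dist_int (G n x - G n x0 - frac (\<alpha> * real (k (s i)))) \<le> \<epsilon> n" if i: "i \<ge> N" for i
      proof -
        have "N \<le> s i" using i seq_suble[OF ts(1), of i] by simp
        then have "G n ((shift ^^ k (s i)) x0) = G n x" using N k orbit agree_mono by metis
        then have "dist_int (G n x - G n x0 - \<alpha> * real (k (s i))) \<le> \<epsilon> n"
          using almost[OF x0, of n "k (s i)"] by simp
        moreover have "dist_int (G n x - G n x0 - frac (\<alpha> * real (k (s i))))
            = dist_int (G n x - G n x0 - \<alpha> * real (k (s i)))"
          by (rule dist_int_cong) (simp add: frac_def)
        ultimately show ?thesis by simp
      qed
      moreover have "continuous_on UNIV (\<lambda>s. dist_int (G n x - G n x0 - s))"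
        by (intro continuous_dist_int continuous_intros)
      then have "(\<lambda>i. dist_int (G n x - G n x0 - frac (\<alpha> * real (k (s i)))))
          \<longlonglongrightarrow> dist_int (G n x - G n x0 - t)"
        using continuous_on_tendsto_compose[OF _ ts(2)] by (fastforce simp: o_def)
      ultimately show ?thesis by (intro LIMSEQ_le_const2) auto
    qed
    then show ?thesis by blast
  qed
  then obtain t where t: "\<And>x n. x \<in> X \<Longrightarrow> dist_int (G n x - G n x0 - t x) \<le> \<epsilon> n" by metis
  have eig: "rmodz (t (shift x)) = rmodz (t x) + rmodz \<alpha>" if x: "x \<in> X" for x
  proof -
    have le: "dist_int (t (shift x) - (t x + \<alpha>)) \<le> 3 * \<epsilon> n" for n
    proof -
      let ?a = "G n (shift x) - G n x0 - t (shift x)" and ?b = "G n x - G n x0 - t x"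
        and ?c = "G n (shift x) - G n x - \<alpha>"
      have "dist_int (?c + (?b + - ?a)) \<le> dist_int ?c + (dist_int ?b + dist_int ?a)"
        using dist_int_add[of ?c "?b + - ?a"] dist_int_add[of ?b "- ?a"]
        unfolding dist_int_minus[of ?a] by (rule order_trans[OF _ add_left_mono])
      moreover have "t (shift x) - (t x + \<alpha>) = ?c + (?b + - ?a)" by simp
      ultimately have "dist_int (t (shift x) - (t x + \<alpha>))
          \<le> dist_int ?c + (dist_int ?b + dist_int ?a)" by (simp only:)
      moreover have "dist_int ?c \<le> \<epsilon> n" using almost[OF x, of n 1] by simp
      ultimately show ?thesis using t[OF x, of n] t[OF inv[OF x], of n] by linarith
    qed
    have "(\<lambda>n. 3 * \<epsilon> n) \<longlonglongrightarrow> 0" using tendsto_mult_left[OF \<epsilon>, of 3] by simp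
    then have "dist_int (t (shift x) - (t x + \<alpha>)) \<le> 0" by (rule LIMSEQ_le_const) (use le in blast)
    then have "dist_int (t (shift x) - (t x + \<alpha>)) = 0" using dist_int_nonneg by (metis antisym)
    then have "rmodz (t (shift x)) = rmodz (t x + \<alpha>)"
      unfolding rmodz_eq_iff by (rule dist_int_eq_0D)
    then show ?thesis by (simp only: plus_rmodz.abs_eq)
  qed
  have "continuous_map (subtopology (biinf_topology A) X) euclidean (\<lambda>x. rmodz (t x))"
    unfolding continuous_on_subshift_iff[OF X]
  proof (intro ballI allI impI)
    fix x and e :: real assume x: "x \<in> X" and e: "e > 0"
    have "eventually (\<lambda>n. \<epsilon> n < e / 2) sequentially"
      using order_tendstoD(2)[OF \<epsilon>, of "e / 2"] e by simp
    then obtain n where n: "\<epsilon> n < e / 2" by (auto simp: eventually_sequentially)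
    obtain N where N: "\<forall>x'\<in>X. agree N x x' \<longrightarrow> G n x' = G n x" using loc[OF x] by blast
    have "circle_norm (rmodz (t y) - rmodz (t x)) < e" if y: "y \<in> X" "agree N x y" for y
    proof -
      have "G n y = G n x" using N y by blast
      then have "t y - t x = (G n x - G n x0 - t x) + - (G n y - G n x0 - t y)" by simp
      then have "dist_int (t y - t x) \<le> dist_int (G n x - G n x0 - t x) + dist_int (G n y - G n x0 - t y)"
        using dist_int_add[of "G n x - G n x0 - t x" "- (G n y - G n x0 - t y)"]
        unfolding dist_int_minus by simp
      also have "\<dots> < e" using t[OF x, of n] t[OF y(1), of n] n by linarith
      finally show ?thesis by (simp only: minus_rmodz.abs_eq circle_norm.abs_eq)
    qed
    then show "\<exists>N. \<forall>y\<in>X. agree N x y \<longrightarrow> circle_norm (rmodz (t y) - rmodz (t x)) < e" by blast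
  qed
  then show ?thesis unfolding continuous_eigenvalue_def using eig by blast
qed

text \<open>The functions \<open>\<rho>\<^sub>n(a) + k \<alpha>\<close> on floors satisfy the
  hypotheses of the previous lemma: between two points of one orbit, the error in the eigenvalue
  equation is the defect of the segment between the bases below them, whatever the number of
  steps.\<close>

lemma eigenvalue_if_return_defects_small:
  assumes ds: "directive_seq A \<tau>" and pr: "primitive A \<tau>" and rec: "recognizable A \<tau>"
    and lim: "(\<lambda>n. Sup (return_defects A \<tau> \<alpha> n (\<rho> n))) \<longlonglongrightarrow> 0"
  shows "continuous_eigenvalue (A 0) (level_shift A \<tau> 0) \<alpha>"
proof -
  let ?X = "level_shift A \<tau> 0"
  let ?f = "\<lambda>n a k. \<rho> n a + \<alpha> * real k"
  let ?P = "\<lambda>n G. (\<forall>y\<in>level_shift A \<tau> n. \<forall>k<height \<tau> n [y 0].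
        G (tower_point \<tau> n y (int k)) = ?f n (y 0) k) \<and>
      (\<forall>x\<in>?X. \<exists>N. \<forall>x'\<in>?X. agree N x x' \<longrightarrow> G x' = G x)"
  \<comment> \<open>Recognizability concerns the levels from 1 on, hence the index \<open>Suc n\<close>.\<close>
  have "\<exists>G. ?P (Suc n) G" for n
  proof -
    have "1 \<le> Suc n" by simp
    then show ?thesis
    proof (rule tower_function[OF ds pr rec, of "Suc n" "?f (Suc n)"])
      fix G
      assume "\<And>y k. y \<in> level_shift A \<tau> (Suc n) \<Longrightarrow> k < height \<tau> (Suc n) [y 0] \<Longrightarrow>
          G (tower_point \<tau> (Suc n) y (int k)) = ?f (Suc n) (y 0) k"
        and "\<And>x. x \<in> ?X \<Longrightarrow> \<exists>N. \<forall>x'\<in>?X. agree N x x' \<longrightarrow> G x' = G x"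
      then show "\<exists>G. ?P (Suc n) G" by (intro exI[of _ G]) blast
    qed
  qed
  then obtain G where "\<And>n. ?P (Suc n) (G n)" by metis
  then have G: "\<And>n y k. y \<in> level_shift A \<tau> (Suc n) \<Longrightarrow> k < height \<tau> (Suc n) [y 0] \<Longrightarrow>
      G n (tower_point \<tau> (Suc n) y (int k)) = ?f (Suc n) (y 0) k"
    and loc: "\<And>n x. x \<in> ?X \<Longrightarrow> \<exists>N. \<forall>x'\<in>?X. agree N x x' \<longrightarrow> G n x' = G n x" by blast+
  define \<epsilon> where "\<epsilon> n = Sup (return_defects A \<tau> \<alpha> (Suc n) (\<rho> (Suc n)))" for n
  have almost: "dist_int (G n ((shift ^^ k) x) - G n x - \<alpha> * real k) \<le> \<epsilon> n" if x: "x \<in> ?X" for n x k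
  proof -
    let ?t = "comp_from_to \<tau> 0 (Suc n)"
    note t = is_substitution_comp_from_to[OF ds, of 0 "Suc n", simplified]
    obtain y i where y: "y \<in> level_shift A \<tau> (Suc n)" and i: "i < height \<tau> (Suc n) [y 0]"
        "x = tower_point \<tau> (Suc n) y (int i)"
      by (rule level_shift_towers[OF ds pr x])
    note yb = level_shift_biinf[OF y]
    obtain j r where jr: "int i + int k = cut ?t y j + int r" "r < height \<tau> (Suc n) [y j]"
        "tower_point \<tau> (Suc n) y (int i + int k) = tower_point \<tau> (Suc n) (translate j y) (int r)"
      by (rule tower_point_locate[OF ds y])
    \<comment> \<open>Blocks with negative index end before coordinate 0, and \<open>i + k\<close> is non-negative.\<close>
    have j: "j \<ge> 0"
    proof (rule ccontr)
      assume "\<not> j \<ge> 0"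
      then have "cut ?t y (j + 1) \<le> 0" using cut_mono[OF t yb, of "j + 1" 0] t by simp
      moreover have "cut ?t y j + int r < cut ?t y (j + 1)"
        using jr(2) cut_Suc[OF t yb, of j] by (simp add: height_def)
      ultimately show False using jr(1) by linarith
    qed
    let ?h = "height \<tau> (Suc n) (map y [0..int (nat j) - 1])"
    have cut: "cut ?t y j = int ?h" using j by (simp add: cut_def height_def)
    have "(shift ^^ k) x = tower_point \<tau> (Suc n) (translate j y) (int r)"
      unfolding jr(3)[symmetric] i(2) by (simp add: funpow_shift tower_point_def add.commute)
    moreover have "translate j y 0 = y j" by (simp add: translate_apply)
    ultimately have "G n ((shift ^^ k) x) = \<rho> (Suc n) (y j) + \<alpha> * real r"
      using G[OF translate_level_shift[OF y, of j]] jr(2) by simp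
    moreover have "G n x = \<rho> (Suc n) (y 0) + \<alpha> * real i" using G[OF y] i by simp
    moreover have "real i + real k = real ?h + real r" using jr(1) cut by linarith
    then have "\<alpha> * real i + \<alpha> * real k = \<alpha> * real ?h + \<alpha> * real r" by (metis distrib_left)
    ultimately have "dist_int (G n ((shift ^^ k) x) - G n x - \<alpha> * real k)
        = dist_int (- (\<rho> (Suc n) (y 0) - \<rho> (Suc n) (y j) + \<alpha> * real ?h))"
      by (intro arg_cong[of _ _ dist_int]) linarith
    also have "\<dots> = dist_int (\<rho> (Suc n) (y 0) - \<rho> (Suc n) (y (int (nat j))) + \<alpha> * real ?h)"
      unfolding dist_int_minus using j by simp
    also have "\<dots> \<le> \<epsilon> n"
      unfolding \<epsilon>_def by (rule cSup_upper[OF _ bdd_above_return_defects])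
        (use y in \<open>auto simp only: return_defects_eq\<close>)
    finally show ?thesis .
  qed
  obtain x0 where x0: "x0 \<in> ?X" using level_shift_nonempty[OF ds pr] by blast
  show ?thesis
  proof (rule continuous_eigenvalue_if_approximations[OF _ x0 _ _ loc almost])
    show "?X \<subseteq> biinf (A 0)" using level_shift_biinf by blast
    show "shift x \<in> ?X" if "x \<in> ?X" for x
      by (rule shift_level_shift[OF that])
    show "\<exists>k. agree N x ((shift ^^ k) x0)" if "x \<in> ?X" for x N
      by (rule dense_forward_orbit[OF ds pr x0 that])
    show "\<epsilon> \<longlonglongrightarrow> 0" unfolding \<epsilon>_def by (rule LIMSEQ_Suc[OF lim])
  qed
qed

theorem theorem4p1:
  fixes A :: "nat \<Rightarrow> 'a set"
    and \<tau> :: "nat \<Rightarrow> 'a list \<Rightarrow> 'a list"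
    and \<alpha> :: real
  assumes "directive_seq A \<tau>"
    and "primitive A \<tau>"
    and "recognizable A \<tau>"
  shows "continuous_eigenvalue (A 0) (level_shift A \<tau> 0) \<alpha> \<longleftrightarrow>
    (\<exists>\<rho> :: nat \<Rightarrow> 'a \<Rightarrow> real.
      (\<lambda>n. Sup {dist_int (\<rho> n (u ! 0) - \<rho> n (u ! k) + \<alpha> * real (height \<tau> n (take k u))) | u k.
                  u \<in> lang (level_shift A \<tau> n) \<and> set u \<subseteq> A n \<and> length u = Suc k})
      \<longlonglongrightarrow> 0)"
  unfolding return_defects_def[symmetric]
  using return_defects_small_if_eigenvalue[OF assms(1,2)]
    eigenvalue_if_return_defects_small[OF assms] by metis

end
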